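(* Every quantum tester that, given quantum oracle access to a Boolean function, distinguishes with bounded error $k$-juntas from functions that are $1/5$-far from every $k$-junta must make $\Omega(k^{1/3})$ queries to the function.
   Context: A $k$-junta is a Boolean function on $\{0,1\}^N$ depending on at most $k$ of its input bits; a function is $1/5$-far from every $k$-junta if it differs from each $k$-junta on at least a $1/5$ fraction of inputs. The tester accesses $f$ via the oracle $|x\rangle\mapsto(-1)^{f(x)}|x\rangle$ (tensored with identity on workspace), and must accept $k$-juntas and reject $1/5$-far functions each with probability at least $2/3$; the lower bound is asymptotic in $k$, with the number of input variables allowed to be chosen. *)

theory Defs
  imports Complex_Main "Jordan_Normal_Form.Schur_Decomposition"
begin

text \<open>
  A point of \<open>{0,1}\<^sup>N\<close> is represented by the natural number \<open>x < 2 ^ N\<close> whose binary digits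
  \<open>bit x 0, \<dots>, bit x (N - 1)\<close> are its coordinates. A Boolean function on \<open>{0,1}\<^sup>N\<close> is a function
  \<open>nat \<Rightarrow> bool\<close> of which only the values below \<open>2 ^ N\<close> matter.
\<close>

definition junta :: "nat \<Rightarrow> nat \<Rightarrow> (nat \<Rightarrow> bool) \<Rightarrow> bool" where
  "junta N k f \<longleftrightarrow>
     (\<exists>J. J \<subseteq> {..<N} \<and> card J \<le> k \<and>
       (\<forall>x < 2 ^ N. \<forall>y < 2 ^ N. (\<forall>i\<in>J. bit x i = bit y i) \<longrightarrow> f x = f y))"

definition bool_dist :: "nat \<Rightarrow> (nat \<Rightarrow> bool) \<Rightarrow> (nat \<Rightarrow> bool) \<Rightarrow> real" where
  "bool_dist N f g = real (card {x. x < 2 ^ N \<and> f x \<noteq> g x}) / 2 ^ N"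

definition far_from_juntas :: "real \<Rightarrow> nat \<Rightarrow> nat \<Rightarrow> (nat \<Rightarrow> bool) \<Rightarrow> bool" where
  "far_from_juntas \<epsilon> N k f \<longleftrightarrow> (\<forall>g. junta N k g \<longrightarrow> \<epsilon> \<le> bool_dist N f g)"

definition unitary_mat :: "nat \<Rightarrow> complex mat \<Rightarrow> bool" where
  "unitary_mat n U \<longleftrightarrow>
     U \<in> carrier_mat n n \<and> mat_adjoint U * U = 1\<^sub>m n \<and> U * mat_adjoint U = 1\<^sub>m n"

text \<open>
  The state space of an algorithm is \<open>\<complex>\<close> to the power \<open>2 ^ N * W\<close>, with the query register tensored
  with a workspace of arbitrary finite dimension \<open>W\<close>. The basis vector \<open>|x\<rangle> \<otimes> |w\<rangle>\<close> has index
  \<open>x * W + w\<close>, so the content of the query register at index \<open>i\<close> is \<open>i div W\<close>.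

  An algorithm making \<open>T\<close> queries starts in the basis state with index 0 and applies
  \<open>U 0, O, U 1, O, \<dots>, O, U T\<close>, where \<open>O\<close> is the oracle and the \<open>U t\<close> are unitaries not depending on the
  input function. It then measures in the computational basis and accepts iff the outcome belongs to
  the set of accepting outcomes. The final unitary is arbitrary, so every two-outcome
  projective measurement is covered.
\<close>

record quantum_algorithm =
  queries :: nat
  workspace_dim :: nat
  unitaries :: "nat \<Rightarrow> complex mat"
  accepting :: "nat set"

definition state_dim :: "nat \<Rightarrow> quantum_algorithm \<Rightarrow> nat" where
  "state_dim N A = 2 ^ N * workspace_dim A"

definition valid_algorithm :: "nat \<Rightarrow> quantum_algorithm \<Rightarrow> bool" where
  "valid_algorithm N A \<longleftrightarrow>
     workspace_dim A \<ge> 1 \<and>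
     (\<forall>t \<le> queries A. unitary_mat (state_dim N A) (unitaries A t)) \<and>
     accepting A \<subseteq> {..<state_dim N A}"

definition phase_oracle :: "nat \<Rightarrow> nat \<Rightarrow> (nat \<Rightarrow> bool) \<Rightarrow> complex mat" where
  "phase_oracle N W f =
     mat (2 ^ N * W) (2 ^ N * W)
       (\<lambda>(i, j). if i = j then (if f (i div W) then - 1 else 1) else 0)"

primrec state_after :: "nat \<Rightarrow> quantum_algorithm \<Rightarrow> (nat \<Rightarrow> bool) \<Rightarrow> nat \<Rightarrow> complex vec" where
  "state_after N A f 0 = unitaries A 0 *\<^sub>v unit_vec (state_dim N A) 0"
| "state_after N A f (Suc t) =
     unitaries A (Suc t) *\<^sub>v (phase_oracle N (workspace_dim A) f *\<^sub>v state_after N A f t)"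

definition outcome_prob ::
    "nat \<Rightarrow> quantum_algorithm \<Rightarrow> (nat \<Rightarrow> bool) \<Rightarrow> nat set \<Rightarrow> real" where
  "outcome_prob N A f S = (\<Sum>i\<in>S. (cmod (state_after N A f (queries A) $ i))\<^sup>2)"

definition accept_prob :: "nat \<Rightarrow> quantum_algorithm \<Rightarrow> (nat \<Rightarrow> bool) \<Rightarrow> real" where
  "accept_prob N A f = outcome_prob N A f (accepting A)"

definition reject_prob :: "nat \<Rightarrow> quantum_algorithm \<Rightarrow> (nat \<Rightarrow> bool) \<Rightarrow> real" where
  "reject_prob N A f = outcome_prob N A f ({..<state_dim N A} - accepting A)"

definition junta_tester :: "real \<Rightarrow> nat \<Rightarrow> nat \<Rightarrow> quantum_algorithm \<Rightarrow> bool" where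
  "junta_tester \<epsilon> N k A \<longleftrightarrow>
     valid_algorithm N A \<and>
     (\<forall>f. junta N k f \<longrightarrow> accept_prob N A f \<ge> 2 / 3) \<and>
     (\<forall>f. far_from_juntas \<epsilon> N k f \<longrightarrow> reject_prob N A f \<ge> 2 / 3)"

end

theory Submission
  imports Defs
begin

text \<open>
  Split the input into \<open>x \<in> {0,1}\<^sup>m\<close> and an address \<open>i < m = 2\<^sup>l\<close>, and for \<open>g : [m] \<rightarrow> [m]\<close>
  let \<open>f\<^sub>g (x, i)\<close> be the bit \<open>x\<close> has at position \<open>g i\<close>. If \<open>g\<close> has at most \<open>r = k - l\<close> values, then \<open>f\<^sub>g\<close> is a
  \<open>k\<close>-junta; if \<open>g\<close> is a permutation and \<open>m \<ge> 2k\<close>, then \<open>f\<^sub>g\<close> is \<open>1/4\<close>-far from every \<open>k\<close>-junta,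
  because a \<open>k\<close>-junta misses the relevant bit for half of the addresses and is then wrong half of the
  time. Take \<open>g = \<sigma> \<circ> h\<close> with \<open>\<sigma>\<close> a uniform permutation and \<open>h : [m] \<rightarrow> [s]\<close> uniform (the small-range
  distributions of Zhandry). The acceptance probability after \<open>T\<close> queries is a polynomial of degree
  \<open>2T\<close> in the signs \<open>(-1)\<^bsup>f(z)\<^esup>\<close>, so its average over \<open>\<sigma>\<close> and \<open>h\<close> is a polynomial \<open>P (1 / s)\<close> of degree at
  most \<open>2T\<close>, whose value \<open>P 0\<close> is the average over permutations. A tester has \<open>P (1 / r) \<ge> 2/3\<close> and
  \<open>P 0 \<le> 1/3\<close>, while \<open>0 \<le> P (1 / s) \<le> 1\<close> for all \<open>s\<close>. Lagrange interpolation at the node \<open>1 / r\<close> and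
  the nodes \<open>1 / \<lfloor>R / j\<^sup>2\<rfloor>\<close>, \<open>1 \<le> j \<le> D = 2T + 1\<close>, with \<open>R = 8 D\<^sup>3\<close>, shows that this is impossible
  unless \<open>r = O(T\<^sup>3)\<close>.
\<close>

section \<open>Polynomials bounded at the points 1/s\<close>

text \<open>Polynomials of degree below \<open>card A\<close> that agree at \<open>card A\<close>
  distinct nodes are equal, so \<open>P\<close> is its own Lagrange interpolant \<open>Q\<close>;
  the weights appear on evaluating \<open>Q\<close> at 0.\<close>

lemma lagrange_at_zero:
  fixes P :: "complex poly" and x :: "nat \<Rightarrow> complex"
  assumes deg: "degree P < card A" and fin: "finite A" and inj: "inj_on x A"
  shows "poly P 0 = (\<Sum>j\<in>A. poly P (x j) * (\<Prod>i\<in>A - {j}. - x i / (x j - x i)))"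
proof -
  define L where "L j = (\<Prod>i\<in>A - {j}. smult (1 / (x j - x i)) [:- x i, 1:])" for j
  define Q where "Q = (\<Sum>j\<in>A. smult (poly P (x j)) (L j))"
  have pL: "poly (L j) z = (\<Prod>i\<in>A - {j}. (z - x i) / (x j - x i))" for j z
    unfolding L_def poly_prod by (intro prod.cong refl) (simp add: diff_divide_distrib[symmetric])
  have L1: "poly (L j) (x j) = 1" if "j \<in> A" for j
    unfolding pL using that inj by (intro prod.neutral) (auto simp: inj_on_def)
  have L0: "poly (L j) (x i) = 0" if "i \<in> A" "i \<noteq> j" for i j
    unfolding pL using that fin by (intro prod_zero) auto
  have degL: "degree (L j) \<le> card A - 1" if "j \<in> A" for j
  proof -
    have "degree (L j) \<le> (\<Sum>i\<in>A - {j}. degree (smult (1 / (x j - x i)) [:- x i, 1:]))"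
      unfolding L_def using degree_prod_sum_le[of "A - {j}" "\<lambda>i. smult (1 / (x j - x i)) [:- x i, 1:]"] fin by (simp add: o_def)
    also have "\<dots> \<le> (\<Sum>i\<in>A - {j}. 1)" by (intro sum_mono) simp
    also have "\<dots> = card A - 1" using that fin by simp
    finally show ?thesis .
  qed
  have "P = Q"
  proof (rule poly_eqI_degree[of "x ` A"])
    show "card (x ` A) > degree P" using deg inj by (simp add: card_image)
    have "degree Q \<le> card A - 1" unfolding Q_def
      using degL by (intro degree_sum_le fin) (meson degree_smult_le order_trans)
    thus "card (x ` A) > degree Q" using deg inj by (simp add: card_image)
    fix z assume "z \<in> x ` A"
    then obtain i where i: "i \<in> A" "z = x i" by auto
    have "poly Q z = (\<Sum>j\<in>A. if j = i then poly P (x j) else 0)"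
      unfolding Q_def poly_sum i(2) using L1 L0 i by (intro sum.cong) auto
    thus "poly P z = poly Q z" using i fin by simp
  qed
  hence "poly P 0 = poly Q 0" by simp
  thus ?thesis unfolding Q_def by (simp add: poly_sum pL)
qed

lemma harmonic_le:
  assumes "n \<ge> (1::nat)" shows "(\<Sum>t=1..n. 1 / real t) \<le> 1 + ln (real n)"
  using assms
proof (induction n rule: nat_induct_at_least)
  case base show ?case by simp
next
  case (Suc n)
  have "ln (real n / real (Suc n)) \<le> real n / real (Suc n) - 1"
    using Suc by (intro ln_le_minus_one) auto
  also have "\<dots> = - 1 / real (Suc n)" by (simp add: field_simps)
  finally have "1 / real (Suc n) \<le> ln (real (Suc n)) - ln (real n)"
    using Suc by (simp add: ln_div)
  then show ?case using Suc by simp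
qed

text \<open>With \<open>a = sqrt n\<close> and \<open>b = sqrt (n + 1)\<close> the new term is at
  most \<open>2 / a - 2 / b\<close>, so the sum telescopes. The subtracted term on the right is what
  lets the induction close.\<close>

lemma sum_three_halves_le:
  assumes "n \<ge> (1::nat)" shows "(\<Sum>j=1..n. 1 / (real j * sqrt (real j))) \<le> 3 - 2 / sqrt (real n)"
  using assms
proof (induction n rule: nat_induct_at_least)
  case base show ?case by simp
next
  case (Suc n)
  define a b where "a = sqrt (real n)" and "b = sqrt (real (Suc n))"
  have a: "a > 0" "b > a" using Suc by (auto simp: a_def b_def)
  have b2: "b * b = real (Suc n)" "a * a = real n" by (auto simp: a_def b_def)
  have "(b - a) * (b + a) = 1" using b2 by (simp add: algebra_simps)
  hence ba: "b - a = 1 / (b + a)" using a by (simp add: field_simps)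
  have "1 / (b * b * b) = 2 / (b * b * (b + b))" using a by (simp add: field_simps)
  also have "\<dots> \<le> 2 / (b * a * (b + a))" using a
    by (intro divide_left_mono mult_mono) auto
  also have "\<dots> = 2 * (b - a) / (b * a)" unfolding ba by simp
  also have "\<dots> = 2 / a - 2 / b" using a by (simp add: field_simps)
  finally show ?case using Suc b2 by (simp add: a_def b_def)
qed

lemma sum_inverse_dist_le:
  assumes "1 \<le> j" "j \<le> D"
  shows "(\<Sum>i\<in>{1..D} - {j}. 1 / \<bar>real i - real j\<bar>) \<le> 2 * (1 + ln (real D))"
proof -
  have split: "{1..D} - {j} = {1..<j} \<union> {j<..D}" using assms by auto
  have "(\<Sum>i\<in>{1..<j}. 1 / \<bar>real i - real j\<bar>) = (\<Sum>t=1..<j. 1 / real t)"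
    by (rule sum.reindex_bij_witness[of _ "\<lambda>t. j - t" "\<lambda>i. j - i"]) (auto simp: of_nat_diff)
  also have "\<dots> \<le> (\<Sum>t=1..D. 1 / real t)" using assms by (intro sum_mono2) auto
  finally have 1: "(\<Sum>i\<in>{1..<j}. 1 / \<bar>real i - real j\<bar>) \<le> (\<Sum>t=1..D. 1 / real t)" .
  have "(\<Sum>i\<in>{j<..D}. 1 / \<bar>real i - real j\<bar>) = (\<Sum>t=1..D-j. 1 / real t)"
    using assms by (intro sum.reindex_bij_witness[of _ "\<lambda>t. j + t" "\<lambda>i. i - j"]) (auto simp: of_nat_diff)
  also have "\<dots> \<le> (\<Sum>t=1..D. 1 / real t)" using assms by (intro sum_mono2) auto
  finally have 2: "(\<Sum>i\<in>{j<..D}. 1 / \<bar>real i - real j\<bar>) \<le> (\<Sum>t=1..D. 1 / real t)" .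
  have "(\<Sum>i\<in>{1..D} - {j}. 1 / \<bar>real i - real j\<bar>) \<le> 2 * (\<Sum>t=1..D. 1 / real t)"
    unfolding split using 1 2 by (subst sum.union_disjoint) auto
  also have "\<dots> \<le> 2 * (1 + ln (real D))" using harmonic_le[of D] assms by simp
  finally show ?thesis .
qed

text \<open>Maximality of the central binomial coefficient among the \<open>2D choose D - j\<close>,
  with denominators cleared.\<close>

lemma fact_sq_le: "j \<le> D \<Longrightarrow> fact D * fact D \<le> fact (D - j) * (fact (D + j) :: real)"
proof (induction j)
  case (Suc j)
  have e: "D - j = Suc (D - Suc j)" using Suc by simp
  have "fact D * fact D \<le> fact (D - j) * (fact (D + j) :: real)" using Suc by simp
  also have "\<dots> = real (D - j) * (fact (D - Suc j) * fact (D + j))"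
    unfolding e by simp
  also have "\<dots> \<le> real (Suc (D + j)) * (fact (D - Suc j) * fact (D + j))"
    by (intro mult_right_mono) auto
  also have "\<dots> = fact (D - Suc j) * fact (D + Suc j)" by simp
  finally show ?case .
qed simp

text \<open>These are the absolute Lagrange weights at 0 for the nodes
  \<open>1, 4, ..., D^2\<close>, equivalently for the unrounded nodes \<open>j^2 / R\<close>. In
  closed form the product is \<open>2 * (D!)^2 / ((D - j)! * (D + j)!)\<close>.\<close>

lemma prod_square_nodes_le:
  assumes "1 \<le> j" "j \<le> D"
  shows "(\<Prod>i\<in>{1..D} - {j}. real i ^ 2 / \<bar>real i ^ 2 - real j ^ 2\<bar>) \<le> 2"
proof -
  have split: "{1..D} - {j} = {1..<j} \<union> {j<..D}" using assms by auto
  have a: "(\<Prod>i\<in>{1..D} - {j}. real i) = fact D / real j"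
    using assms by (subst prod_diff1) (auto simp: fact_prod)
  have "(\<Prod>i\<in>{1..D}. real i + real j) = fact (D + j) / fact j" for D
  proof (induction D)
    case (Suc D)
    have "(\<Prod>i\<in>{1..Suc D}. real i + real j) = (\<Prod>i\<in>{1..D}. real i + real j) * (real (Suc D) + real j)"
      by simp
    also have "\<dots> = fact (D + j) * real (Suc (D + j)) / fact j" unfolding Suc by simp
    also have "\<dots> = fact (Suc D + j) / fact j" by (simp add: mult.commute)
    finally show ?case .
  qed simp
  hence b: "(\<Prod>i\<in>{1..D} - {j}. real i + real j) = fact (D + j) / fact j / (2 * real j)"
    using assms by (subst prod_diff1) auto
  have c1: "(\<Prod>i\<in>{1..<j}. \<bar>real i - real j\<bar>) = fact (j - 1)"
  proof -
    have "(\<Prod>i\<in>{1..<j}. \<bar>real i - real j\<bar>) = (\<Prod>t\<in>{1..j-1}. real t)"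
      by (rule prod.reindex_bij_witness[of _ "\<lambda>t. j - t" "\<lambda>i. j - i"]) (auto simp: of_nat_diff)
    thus ?thesis by (simp add: fact_prod)
  qed
  have c2: "(\<Prod>i\<in>{j<..D}. \<bar>real i - real j\<bar>) = fact (D - j)"
  proof -
    have "(\<Prod>i\<in>{j<..D}. \<bar>real i - real j\<bar>) = (\<Prod>t\<in>{1..D-j}. real t)"
      using assms by (intro prod.reindex_bij_witness[of _ "\<lambda>t. j + t" "\<lambda>i. i - j"]) (auto simp: of_nat_diff)
    thus ?thesis by (simp add: fact_prod)
  qed
  have c: "(\<Prod>i\<in>{1..D} - {j}. \<bar>real i - real j\<bar>) = fact (j - 1) * fact (D - j)"
    unfolding split c1[symmetric] c2[symmetric] by (subst prod.union_disjoint) auto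
  have "(\<Prod>i\<in>{1..D} - {j}. real i ^ 2 / \<bar>real i ^ 2 - real j ^ 2\<bar>)
      = (\<Prod>i\<in>{1..D} - {j}. real i * real i / ((real i + real j) * \<bar>real i - real j\<bar>))"
    by (intro prod.cong refl) (simp add: power2_eq_square square_diff_square_factored abs_mult)
  also have "\<dots> = (fact D / real j) * (fact D / real j) /
      (fact (D + j) / fact j / (2 * real j) * (fact (j - 1) * fact (D - j)))"
    unfolding prod_dividef prod.distrib a b c ..
  also have "\<dots> = 2 * (fact D * fact D / (fact (D - j) * fact (D + j)))"
  proof -
    have alg: "F / r * (F / r) / (G / (r * p) / (2 * r) * (p * q)) = 2 * (F * F / (q * G))"
      if "r > 0" "p > 0" "q > 0" "G > 0" for F G r p q :: real
      using that by (simp add: divide_simps)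
    have "fact j = real j * fact (j - 1)" using assms by (simp add: fact_reduce)
    thus ?thesis using assms by (simp only:) (rule alg, auto)
  qed
  also have "\<dots> \<le> 2 * 1" using fact_sq_le[OF assms(2)] by (intro mult_left_mono) (auto simp: field_simps)
  finally show ?thesis by simp
qed

text \<open>Rounding costs each factor of the preceding product at most
  \<open>1 / (1 - u i j) <= exp (2 * u i j)\<close>. The choice of \<open>R\<close> keeps the sum of
  the \<open>u i j\<close> over \<open>i\<close> below \<open>5 / 8 + ln j / 4\<close>, so the total
  loss is a constant times \<open>sqrt j\<close>.\<close>

lemma prod_rounded_nodes_le:
  assumes j: "1 \<le> j" "j \<le> D"
  defines "R \<equiv> 8 * D ^ 3"
  shows "(\<Prod>i\<in>{1..D} - {j}. real (R div j\<^sup>2) / \<bar>real (R div j\<^sup>2) - real (R div i\<^sup>2)\<bar>) \<le> 18 * sqrt (real j)"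
    and "inj_on (\<lambda>i. R div i\<^sup>2) {1..D}"
proof -
  have D: "D \<ge> 1" using j by simp
  have R: "real R = 8 * real D ^ 3" "real R > 0" using D by (auto simp: R_def)
  \<comment> \<open>\<open>u i j\<close> is the inverse of \<open>\<bar>R / i\<^sup>2 - R / j\<^sup>2\<bar>\<close>: rounding leaves at least the fraction
    \<open>1 - u i j\<close> of that gap.\<close>
  define u where "u i j = (real i)\<^sup>2 * (real j)\<^sup>2 / (real R * \<bar>(real i)\<^sup>2 - (real j)\<^sup>2\<bar>)" for i j
  \<comment> \<open>Splits \<open>i^2 / \<bar>i^2 - j^2\<bar>\<close> into a constant and a multiple
    of \<open>1 / \<bar>i - j\<bar>\<close>; summed over \<open>i\<close>, the second part is
    controlled by harmonic sums.\<close>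
  have u_le: "u i j \<le> (real j)\<^sup>2 / real R * (1 + real j / \<bar>real i - real j\<bar>)"
    if "i \<in> {1..D} - {j}" "j \<in> {1..D}" for i j
  proof -
    have p: "real i > 0" "real j > 0" "\<bar>real i - real j\<bar> > 0" using that by auto
    have "real i * real i \<le> (real i + real j) * real i" by (simp add: algebra_simps)
    also have "\<dots> \<le> (real i + real j) * (\<bar>real i - real j\<bar> + real j)"
      by (intro mult_left_mono) auto
    finally have "real i * real i \<le> (real i + real j) * (\<bar>real i - real j\<bar> + real j)" .
    hence "(real i * real i) / ((real i + real j) * \<bar>real i - real j\<bar>) \<le>
        ((real i + real j) * (\<bar>real i - real j\<bar> + real j)) / ((real i + real j) * \<bar>real i - real j\<bar>)"
      using p by (intro divide_right_mono) auto
    also have "\<dots> = 1 + real j / \<bar>real i - real j\<bar>" using p by (simp add: add_divide_distrib)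
    finally have *: "(real i * real i) / ((real i + real j) * \<bar>real i - real j\<bar>) \<le> 1 + real j / \<bar>real i - real j\<bar>" .
    have "u i j = (real j)\<^sup>2 / real R * ((real i * real i) / ((real i + real j) * \<bar>real i - real j\<bar>))"
      using p by (simp add: u_def power2_eq_square square_diff_square_factored abs_mult)
    also have "\<dots> \<le> (real j)\<^sup>2 / real R * (1 + real j / \<bar>real i - real j\<bar>)"
      using R by (intro mult_left_mono *) auto
    finally show ?thesis .
  qed
  have u_half: "u i j \<le> 1 / 2" if "i \<in> {1..D} - {j}" "j \<in> {1..D}" for i j
  proof -
    have "1 \<le> \<bar>real i - real j\<bar>" using that by auto
    hence "real j / \<bar>real i - real j\<bar> \<le> real j / 1" by (intro divide_left_mono) auto
    hence "1 + real j / \<bar>real i - real j\<bar> \<le> 2 * real D" using that D by auto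
    moreover have "(real j)\<^sup>2 / real R \<le> (real D)\<^sup>2 / real R" using that R by (intro divide_right_mono power_mono) auto
    ultimately have "(real j)\<^sup>2 / real R * (1 + real j / \<bar>real i - real j\<bar>) \<le> (real D)\<^sup>2 / real R * (2 * real D)"
      using R by (intro mult_mono) auto
    also have "\<dots> \<le> 1 / 2" using D by (simp add: R power2_eq_square power3_eq_cube)
    finally show ?thesis by (rule order_trans[OF u_le[OF that]])
  qed
  have n_le: "real (R div i\<^sup>2) \<le> real R / (real i)\<^sup>2" for i
    using of_nat_div_le_of_nat[of R "i\<^sup>2", where ?'a = real] unfolding of_nat_power .
  have n_ge: "real (R div i\<^sup>2) \<ge> real R / (real i)\<^sup>2 - 1" for i
    using floor_divide_of_nat_eq[of R "i\<^sup>2", where ?'a = real]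
      real_of_int_floor_add_one_gt[of "real R / real (i\<^sup>2)"] by simp
  have gap: "\<bar>real (R div j\<^sup>2) - real (R div i\<^sup>2)\<bar> \<ge>
      (real R * \<bar>(real i)\<^sup>2 - (real j)\<^sup>2\<bar> / ((real i)\<^sup>2 * (real j)\<^sup>2)) * (1 - u i j)"
    if "i \<in> {1..D} - {j}" "j \<in> {1..D}" for i j
  proof -
    have p: "real i > 0" "real j > 0" using that by auto
    have sq: "(real i)\<^sup>2 \<noteq> (real j)\<^sup>2" using that p by (auto simp: power2_eq_iff)
    have "real R / (real j)\<^sup>2 - real R / (real i)\<^sup>2 = real R * ((real i)\<^sup>2 - (real j)\<^sup>2) / ((real i)\<^sup>2 * (real j)\<^sup>2)"
      using p by (simp add: field_simps)
    hence "\<bar>real R / (real j)\<^sup>2 - real R / (real i)\<^sup>2\<bar> = real R * \<bar>(real i)\<^sup>2 - (real j)\<^sup>2\<bar> / ((real i)\<^sup>2 * (real j)\<^sup>2)"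
      using p R by (simp add: abs_mult)
    \<comment> \<open>Both quotients are rounded down by at most 1, so their difference shrinks by
      at most 1, which is the fraction \<open>u i j\<close> of the exact gap.\<close>
    moreover have "real R * \<bar>(real i)\<^sup>2 - (real j)\<^sup>2\<bar> / ((real i)\<^sup>2 * (real j)\<^sup>2) * u i j = 1"
      using p R sq by (simp add: u_def)
    ultimately show ?thesis
      using n_le[of i] n_le[of j] n_ge[of i] n_ge[of j] unfolding right_diff_distrib by linarith
  qed
  have gap_pos: "real R * \<bar>(real i)\<^sup>2 - (real j)\<^sup>2\<bar> / ((real i)\<^sup>2 * (real j)\<^sup>2) > 0"
    if "i \<in> {1..D} - {j}" "j \<in> {1..D}" for i j
  proof -
    have "real i > 0" "real j > 0" using that by auto
    moreover from this have "(real i)\<^sup>2 \<noteq> (real j)\<^sup>2" using that by (auto simp: power2_eq_iff)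
    ultimately show ?thesis using R by simp
  qed
  show "inj_on (\<lambda>i. R div i\<^sup>2) {1..D}"
  proof (rule inj_onI, rule ccontr)
    fix i k assume ik: "i \<in> {1..D}" "k \<in> {1..D}" "R div i\<^sup>2 = R div k\<^sup>2" "i \<noteq> k"
    then have m: "i \<in> {1..D} - {k}" by auto
    have "0 < (real R * \<bar>(real i)\<^sup>2 - (real k)\<^sup>2\<bar> / ((real i)\<^sup>2 * (real k)\<^sup>2)) * (1 - u i k)"
      using gap_pos[OF m ik(2)] u_half[OF m ik(2)] by (intro mult_pos_pos) auto
    thus False using gap[OF m ik(2)] ik(3) by simp
  qed
  have jD: "j \<in> {1..D}" using j by auto
  have factor: "real (R div j\<^sup>2) / \<bar>real (R div j\<^sup>2) - real (R div i\<^sup>2)\<bar> \<le>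
      real i ^ 2 / \<bar>real i ^ 2 - real j ^ 2\<bar> * exp (2 * u i j)"
    if m: "i \<in> {1..D} - {j}" for i
  proof -
    define a where "a = real R * \<bar>(real i)\<^sup>2 - (real j)\<^sup>2\<bar> / ((real i)\<^sup>2 * (real j)\<^sup>2)"
    have p: "real i > 0" "real j > 0" using m jD by auto
    have sq: "(real i)\<^sup>2 \<noteq> (real j)\<^sup>2" using m p by (auto simp: power2_eq_iff)
    have u: "u i j \<le> 1 / 2" "u i j \<ge> 0" using u_half[OF m jD] by (auto simp: u_def)
    have a: "a > 0" using gap_pos[OF m jD] by (simp add: a_def)
    have "real (R div j\<^sup>2) / \<bar>real (R div j\<^sup>2) - real (R div i\<^sup>2)\<bar> \<le> (real R / (real j)\<^sup>2) / (a * (1 - u i j))"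
      using gap[OF m jD] a u n_le[of j] unfolding a_def[symmetric] by (intro frac_le mult_pos_pos) auto
    also have "\<dots> = (real R / (real j)\<^sup>2) / a * (1 / (1 - u i j))" by simp
    also have "(real R / (real j)\<^sup>2) / a = real i ^ 2 / \<bar>real i ^ 2 - real j ^ 2\<bar>"
      using p R sq by (simp add: a_def)
    also have "real i ^ 2 / \<bar>real i ^ 2 - real j ^ 2\<bar> * (1 / (1 - u i j)) \<le>
        real i ^ 2 / \<bar>real i ^ 2 - real j ^ 2\<bar> * exp (2 * u i j)"
    proof (intro mult_left_mono)
      \<comment> \<open>The product is \<open>1 + u * (1 - 2 * u)\<close>, hence the need for
        \<open>u \<le> 1 / 2\<close>.\<close>
      have "1 \<le> (1 + 2 * u i j) * (1 - u i j)"
        using mult_right_mono[of "2 * u i j" 1 "u i j"] u by (simp add: algebra_simps)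
      hence "1 / (1 - u i j) \<le> 1 + 2 * u i j" using u by (simp add: divide_le_eq)
      also have "\<dots> \<le> exp (2 * u i j)" by (rule exp_ge_add_one_self)
      finally show "1 / (1 - u i j) \<le> exp (2 * u i j)" .
    qed auto
    finally show ?thesis .
  qed
  have usum: "(\<Sum>i\<in>{1..D} - {j}. u i j) \<le> 5 / 8 + ln (real j) / 4"
  proof -
    \<comment> \<open>Trades \<open>ln D\<close> for \<open>ln j\<close>, so that the final bound
      does not depend on \<open>D\<close>: the difference \<open>ln (D / j)\<close> is at most
      \<open>D / j\<close>, which the cube absorbs.\<close>
    have lnD: "(real j / real D) ^ 3 * ln (real D) \<le> ln (real j) + 1"
    proof -
      define y where "y = real j / real D"
      have y: "0 < y" "y \<le> 1" using j by (auto simp: y_def)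
      have y3: "y ^ 3 \<le> 1" "y ^ 3 \<ge> 0" using y by (auto simp: power_le_one)
      have "ln (1 / y) \<le> 1 / y - 1" using y by (intro ln_le_minus_one) auto
      moreover have "ln (real D) = ln (real j) + ln (1 / y)" using j by (simp add: y_def ln_div)
      ultimately have "ln (real D) \<le> ln (real j) + 1 / y" by simp
      hence "y ^ 3 * ln (real D) \<le> y ^ 3 * (ln (real j) + 1 / y)" using y3 by (intro mult_left_mono)
      also have "\<dots> = y ^ 3 * ln (real j) + y ^ 2" using y by (simp add: field_simps power2_eq_square power3_eq_cube)
      also have "\<dots> \<le> 1 * ln (real j) + 1"
        using y y3 j by (intro add_mono mult_right_mono) (auto simp: power_le_one)
      finally show ?thesis by (simp add: y_def)
    qed
    have "(\<Sum>i\<in>{1..D} - {j}. u i j) \<le> (\<Sum>i\<in>{1..D} - {j}. (real j)\<^sup>2 / real R * (1 + real j / \<bar>real i - real j\<bar>))"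
      using u_le jD by (intro sum_mono) auto
    also have "\<dots> = (real j)\<^sup>2 / real R * (real (D - 1) + real j * (\<Sum>i\<in>{1..D} - {j}. 1 / \<bar>real i - real j\<bar>))"
      using jD by (simp add: sum_distrib_left sum.distrib distrib_left)
    also have "\<dots> \<le> (real j)\<^sup>2 / real R * (real D + real j * (2 * (1 + ln (real D))))"
      using R sum_inverse_dist_le[OF j] by (intro mult_left_mono add_mono) auto
    also have "\<dots> = (real j / real D)\<^sup>2 / 8 + (real j / real D) ^ 3 / 4 + (real j / real D) ^ 3 * ln (real D) / 4"
      using D by (simp add: R field_simps power2_eq_square power3_eq_cube)
    also have "\<dots> \<le> 1 / 8 + 1 / 4 + (ln (real j) + 1) / 4"
      using j lnD by (intro add_mono divide_right_mono) (auto simp: power_le_one)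
    finally show ?thesis by (simp add: add_divide_distrib)
  qed
  have "(\<Prod>i\<in>{1..D} - {j}. real (R div j\<^sup>2) / \<bar>real (R div j\<^sup>2) - real (R div i\<^sup>2)\<bar>) \<le>
     (\<Prod>i\<in>{1..D} - {j}. real i ^ 2 / \<bar>real i ^ 2 - real j ^ 2\<bar> * exp (2 * u i j))"
    using factor by (intro prod_mono) auto
  also have "\<dots> = (\<Prod>i\<in>{1..D} - {j}. real i ^ 2 / \<bar>real i ^ 2 - real j ^ 2\<bar>) * exp (2 * (\<Sum>i\<in>{1..D} - {j}. u i j))"
    by (simp only: prod.distrib exp_sum[symmetric] finite_Diff finite_atLeastAtMost sum_distrib_left)
  also have "\<dots> \<le> 2 * exp (2 * (5 / 8 + ln (real j) / 4))"
    using prod_square_nodes_le[OF j] usum by (intro mult_mono) (auto intro: prod_nonneg)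
  \<comment> \<open>The term \<open>ln j / 4\<close>, doubled, becomes \<open>sqrt j\<close> under
    the exponential; the constant 18 is twice the crude bound 9 for
    \<open>exp (5 / 4)\<close>.\<close>
  also have "exp (2 * (5 / 8 + ln (real j) / 4)) = exp (5 / 4) * sqrt (real j)"
    using j by (simp add: exp_add ring_distribs ln_sqrt[symmetric])
  also have "2 * (exp (5 / 4) * sqrt (real j)) \<le> 2 * (9 * sqrt (real j))"
  proof (intro mult_left_mono mult_right_mono)
    have "exp (5 / 4 :: real) \<le> exp (1 + 1)" by simp
    also have "\<dots> = exp 1 * exp 1" by (rule exp_add)
    also have "\<dots> \<le> 3 * 3" using exp_le by (intro mult_mono) auto
    finally show "exp (5 / 4 :: real) \<le> 9" by simp
  qed auto
  finally show "(\<Prod>i\<in>{1..D} - {j}. real (R div j\<^sup>2) / \<bar>real (R div j\<^sup>2) - real (R div i\<^sup>2)\<bar>) \<le> 18 * sqrt (real j)"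
    by simp
qed

text \<open>The interpolation weights sum to 1, so \<open>poly P 0 - q r\<close> is the weighted sum
  of the differences \<open>q (n j) - q r\<close>. The node \<open>n 0 = r\<close> drops out, and
  its large distance from the other nodes makes their weights decay like \<open>j\<close> to the
  power \<open>-3/2\<close>, with a small total.\<close>

lemma poly_inverse_nodes_close:
  fixes P :: "complex poly" and q :: "nat \<Rightarrow> real"
  assumes D: "D \<ge> 1" and deg: "degree P \<le> D" and r: "r \<ge> 1600 * D ^ 3"
    and q: "\<And>s. 1 \<le> s \<Longrightarrow> s \<le> r \<Longrightarrow> poly P (1 / of_nat s) = of_real (q s) \<and> 0 \<le> q s \<and> q s \<le> 1"
  shows "cmod (poly P 0 - of_real (q r)) < 1 / 3"
proof -
  define R where "R = 8 * D ^ 3"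
  define n where "n j = (if j = 0 then r else R div j\<^sup>2)" for j
  \<comment> \<open>The Lagrange weight at 0 of the node \<open>1 / n j\<close>, with the inverses
    cleared.\<close>
  define w where "w j = (\<Prod>i\<in>{..D} - {j}. real (n j) / (real (n j) - real (n i)))" for j
  have R: "R > 0" "r \<ge> 200 * R" using D r by (auto simp: R_def)
  have n_pos: "n j \<ge> 1" if "j \<le> D" for j
  proof (cases "j = 0")
    case False
    have "j\<^sup>2 \<le> D\<^sup>2" using that by (simp add: power_mono)
    also have "\<dots> \<le> R" using D by (simp add: R_def power2_eq_square power3_eq_cube)
    finally have "R div j\<^sup>2 \<noteq> 0" using False by (simp add: div_eq_0_iff)
    thus ?thesis using False by (simp add: n_def)
  qed (use R in \<open>simp add: n_def\<close>)
  have n_le: "n j \<le> R" if "j \<noteq> 0" for j using that by (simp add: n_def)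
  have n_r: "n j \<le> r" for j using n_le[of j] R by (cases "j = 0") (simp add: n_def, linarith)
  have inj1: "inj_on n {1..D}"
  proof (rule inj_onI)
    fix i j assume "i \<in> {1..D}" "j \<in> {1..D}" "n i = n j"
    thus "i = j"
      using prod_rounded_nodes_le(2)[OF D order_refl, THEN inj_onD, of i j]
      by (simp add: n_def R_def)
  qed
  have inj: "inj_on n {..D}"
  proof (rule inj_onI)
    fix i j assume "i \<in> {..D}" "j \<in> {..D}" "n i = n j"
    moreover have "n i \<noteq> n 0" if "i \<noteq> 0" for i
      using n_le[OF that] R by (simp add: n_def)
    ultimately show "i = j" using inj1[THEN inj_onD, of i j]
      by (cases "i = 0"; cases "j = 0") (simp_all, metis)
  qed
  have interp: "poly Q 0 = (\<Sum>j\<le>D. poly Q (1 / of_nat (n j)) * of_real (w j))"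
    if "degree Q \<le> D" for Q :: "complex poly"
  proof -
    have "inj_on (\<lambda>j. 1 / of_nat (n j) :: complex) {..D}"
      using inj by (auto simp: inj_on_def)
    hence "poly Q 0 = (\<Sum>j\<le>D. poly Q (1 / of_nat (n j)) *
        (\<Prod>i\<in>{..D} - {j}. - (1 / of_nat (n i)) / (1 / of_nat (n j) - 1 / of_nat (n i))))"
      using that by (intro lagrange_at_zero) auto
    also have "\<dots> = (\<Sum>j\<le>D. poly Q (1 / of_nat (n j)) * of_real (w j))"
    proof (intro sum.cong refl arg_cong2[where f = "(*)"])
      fix j assume j: "j \<in> {..D}"
      have "- (1 / of_nat (n i)) / (1 / of_nat (n j) - 1 / of_nat (n i)) =
          (of_nat (n j) / (of_nat (n j) - of_nat (n i)) :: complex)" if "i \<in> {..D} - {j}" for i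
      proof -
        have "n i \<noteq> n j" using that j inj by (auto simp: inj_on_def)
        moreover have "n i \<noteq> 0" "n j \<noteq> 0" using that j n_pos[of i] n_pos[of j] by auto
        ultimately show ?thesis by (simp add: divide_simps) (simp add: algebra_simps)
      qed
      thus "(\<Prod>i\<in>{..D} - {j}. - (1 / of_nat (n i)) / (1 / of_nat (n j) - 1 / of_nat (n i))) = complex_of_real (w j)"
        by (simp add: w_def)
    qed
    finally show ?thesis .
  qed
  \<comment> \<open>Interpolation of the constant polynomial 1.\<close>
  have "(\<Sum>j\<le>D. complex_of_real (w j)) = 1" using interp[of 1] by simp
  hence "poly P 0 - of_real (q r) = (\<Sum>j\<le>D. poly P (1 / of_nat (n j)) * of_real (w j)) - of_real (q r) * (\<Sum>j\<le>D. complex_of_real (w j))"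
    using interp[OF deg] by simp
  also have "\<dots> = (\<Sum>j\<le>D. of_real ((q (n j) - q r) * w j))"
    unfolding sum_distrib_left sum_subtractf[symmetric]
    using q n_pos n_r by (intro sum.cong) (auto simp: algebra_simps)
  \<comment> \<open>The term for \<open>j = 0\<close> vanishes because \<open>n 0 = r\<close>; the
    weight \<open>w 0\<close> therefore needs no estimate.\<close>
  also have "\<dots> = (\<Sum>j=1..D. of_real ((q (n j) - q r) * w j))"
    by (intro sum.mono_neutral_right) (auto simp: n_def)
  finally have "cmod (poly P 0 - of_real (q r)) \<le> (\<Sum>j=1..D. cmod (of_real ((q (n j) - q r) * w j)))"
    using norm_sum by simp
  also have "\<dots> \<le> (\<Sum>j=1..D. 18 / 199 * (1 / (real j * sqrt (real j))))"
  proof (rule sum_mono)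
    fix j assume j: "j \<in> {1..D}"
    have qd: "\<bar>q (n j) - q r\<bar> \<le> 1"
      using q[of "n j"] q[of r] n_pos[of j] n_pos[of 0] n_r[of j] j by (auto simp: n_def)
    have split: "{..D} - {j} = insert 0 ({1..D} - {j})" using j by auto
    have p: "\<bar>w j\<bar> = (real (n j) / \<bar>real (n j) - real r\<bar>) * (\<Prod>i\<in>{1..D} - {j}. real (n j) / \<bar>real (n j) - real (n i)\<bar>)"
      unfolding w_def split by (simp add: abs_mult abs_prod n_def)
    \<comment> \<open>The factor belonging to the node \<open>r\<close>. Its decay in
      \<open>j\<close> outweighs the growth \<open>sqrt j\<close> of the remaining factors.\<close>
    have b: "real (n j) / \<bar>real (n j) - real r\<bar> \<le> 1 / (199 * (real j)\<^sup>2)"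
    proof -
      have rr: "real r \<ge> 200 * real R" using R(2) by (metis of_nat_le_iff of_nat_mult of_nat_numeral)
      have nR: "real (R div j\<^sup>2) \<le> real R" by (simp add: div_le_dividend)
      have "199 * real R \<le> \<bar>real (R div j\<^sup>2) - real r\<bar>" using nR rr by linarith
      hence "real (n j) / \<bar>real (n j) - real r\<bar> \<le> (real R / (real j)\<^sup>2) / (199 * real R)"
        using of_nat_div_le_of_nat[of R "j\<^sup>2", where ?'a = real] j R(1)
        by (intro frac_le) (simp_all add: n_def)
      thus ?thesis using R(1) by (simp add: field_simps)
    qed
    have c: "(\<Prod>i\<in>{1..D} - {j}. real (n j) / \<bar>real (n j) - real (n i)\<bar>) \<le> 18 * sqrt (real j)"
    proof -
      have "(\<Prod>i\<in>{1..D} - {j}. real (n j) / \<bar>real (n j) - real (n i)\<bar>) =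
         (\<Prod>i\<in>{1..D} - {j}. real (R div j\<^sup>2) / \<bar>real (R div j\<^sup>2) - real (R div i\<^sup>2)\<bar>)"
        using j by (intro prod.cong) (auto simp: n_def)
      thus ?thesis using prod_rounded_nodes_le(1)[of j D] j by (simp add: R_def)
    qed
    have d: "0 \<le> (\<Prod>i\<in>{1..D} - {j}. real (n j) / \<bar>real (n j) - real (n i)\<bar>)"
      by (intro prod_nonneg) auto
    have "cmod (of_real ((q (n j) - q r) * w j)) = \<bar>q (n j) - q r\<bar> * \<bar>w j\<bar>"
      by (simp add: abs_mult norm_mult del: of_real_mult of_real_diff)
    also have "\<dots> \<le> 1 * (1 / (199 * (real j)\<^sup>2) * (18 * sqrt (real j)))"
      unfolding p using qd b c d by (intro mult_mono mult_nonneg_nonneg) auto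
    also have "\<dots> = 18 / 199 * (1 / (real j * sqrt (real j)))"
    proof -
      have alg: "1 * (1 / (199 * (s * s)\<^sup>2) * (18 * s)) = 18 / 199 * (1 / (s * s * s))" if "s > 0" for s :: real
        using that by (simp add: power2_eq_square)
      show ?thesis using alg[of "sqrt (real j)"] j by simp
    qed
    finally show "cmod (of_real ((q (n j) - q r) * w j)) \<le> 18 / 199 * (1 / (real j * sqrt (real j)))" .
  qed
  also have "\<dots> = 18 / 199 * (\<Sum>j=1..D. 1 / (real j * sqrt (real j)))" by (rule sum_distrib_left[symmetric])
  \<comment> \<open>Here \<open>54 / 199 < 1 / 3\<close>. The factor 199 comes from
    \<open>r \<ge> 200 * R\<close>, that is, from \<open>1600 = 200 * 8\<close>.\<close>
  also have "\<dots> \<le> 18 / 199 * 3"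
  proof -
    have "2 / sqrt (real D) \<ge> 0" by simp
    thus ?thesis using sum_three_halves_le[OF D] by (intro mult_left_mono) linarith+
  qed
  finally show ?thesis by simp
qed

section \<open>Averages over maps of small range\<close>

lemma exists_permutation_extending:
  assumes "finite A" "I \<subseteq> A" "inj_on g I" "g ` I \<subseteq> A"
  shows "\<exists>p. p permutes A \<and> (\<forall>i\<in>I. p i = g i)"
proof -
  have "card (A - I) = card (A - g ` I)"
    using card_Diff_subset[OF finite_subset[OF assms(2,1)] assms(2)]
      card_Diff_subset[OF finite_subset[OF assms(4,1)] assms(4)] card_image[OF assms(3)] by presburger
  then obtain \<beta> where \<beta>: "bij_betw \<beta> (A - I) (A - g ` I)"
    using finite_same_card_bij[OF finite_Diff[OF assms(1)] finite_Diff[OF assms(1)]] by blast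
  define p where "p x = (if x \<in> I then g x else if x \<in> A then \<beta> x else x)" for x
  have "bij_betw p I (g ` I)" using assms(3) by (simp add: p_def bij_betw_def cong: inj_on_cong)
  moreover have "bij_betw p (A - I) (A - g ` I)"
    using \<beta> by (subst bij_betw_cong[of _ _ \<beta>]) (auto simp: p_def)
  ultimately have "bij_betw p (I \<union> (A - I)) (g ` I \<union> (A - g ` I))"
    by (intro bij_betw_combine) auto
  hence "bij_betw p A A" using assms by (simp add: Un_absorb1)
  hence "p permutes A" using assms(2) by (intro bij_imp_permutes) (auto simp: p_def)
  thus ?thesis by (intro exI[of _ p]) (auto simp: p_def)
qed

text \<open>The expectation of \<open>\<phi>\<close> when the listed coordinates of \<open>g\<close>
  are redrawn uniformly from \<open>{..<r}\<close>. Drawing them one at a time, rather than summing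
  over a function space, permits induction on the coordinates.\<close>

primrec iter_avg :: "nat \<Rightarrow> nat list \<Rightarrow> ((nat \<Rightarrow> nat) \<Rightarrow> complex) \<Rightarrow> (nat \<Rightarrow> nat) \<Rightarrow> complex" where
  "iter_avg r [] \<phi> g = \<phi> g"
| "iter_avg r (i # is) \<phi> g = (\<Sum>c<r. iter_avg r is \<phi> (g(i := c))) / of_nat r"

lemma iter_avg_add: "iter_avg r is (\<lambda>g. \<phi> g + \<psi> g) g = iter_avg r is \<phi> g + iter_avg r is \<psi> g"
  by (induction "is" arbitrary: g) (auto simp: sum.distrib add_divide_distrib)

lemma iter_avg_scale: "iter_avg r is (\<lambda>g. a * \<phi> g) g = a * iter_avg r is \<phi> g"
  by (induction "is" arbitrary: g) (auto simp: sum_distrib_left)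

lemma iter_avg_real:
  assumes "r \<ge> 1" "\<And>h. (\<forall>i\<in>set is. h i < r) \<Longrightarrow> (\<forall>i. i \<notin> set is \<longrightarrow> h i = g i) \<Longrightarrow>
      \<phi> h \<in> \<real> \<and> a \<le> Re (\<phi> h) \<and> Re (\<phi> h) \<le> b"
  shows "iter_avg r is \<phi> g \<in> \<real> \<and> a \<le> Re (iter_avg r is \<phi> g) \<and> Re (iter_avg r is \<phi> g) \<le> b"
  using assms(2)
proof (induction "is" arbitrary: g)
  case (Cons i "is")
  have IH: "iter_avg r is \<phi> (g(i := c)) \<in> \<real> \<and> a \<le> Re (iter_avg r is \<phi> (g(i := c))) \<and>
      Re (iter_avg r is \<phi> (g(i := c))) \<le> b" if "c < r" for c
  proof (rule Cons.IH)
    fix h assume h: "\<forall>i\<in>set is. h i < r" "\<forall>j. j \<notin> set is \<longrightarrow> h j = (g(i := c)) j"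
    show "\<phi> h \<in> \<real> \<and> a \<le> Re (\<phi> h) \<and> Re (\<phi> h) \<le> b"
    proof (rule Cons.prems)
      have "h i < r" using h that by (cases "i \<in> set is") auto
      thus "\<forall>j\<in>set (i # is). h j < r" using h by auto
      show "\<forall>j. j \<notin> set (i # is) \<longrightarrow> h j = g j" using h by auto
    qed
  qed
  have "(\<Sum>c<r. iter_avg r is \<phi> (g(i := c))) \<in> \<real>" using IH by (intro sum_in_Reals) auto
  moreover have "real r * a \<le> (\<Sum>c<r. Re (iter_avg r is \<phi> (g(i := c))))"
    using sum_bounded_below[of "{..<r}" a "\<lambda>c. Re (iter_avg r is \<phi> (g(i := c)))"] IH by auto
  moreover have "(\<Sum>c<r. Re (iter_avg r is \<phi> (g(i := c)))) \<le> real r * b"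
    using sum_bounded_above[of "{..<r}" "\<lambda>c. Re (iter_avg r is \<phi> (g(i := c)))" b] IH by auto
  ultimately show ?case using assms(1) by (simp add: Reals_divide pos_le_divide_eq pos_divide_le_eq mult.commute Re_divide_of_nat)
qed auto

text \<open>Redrawing a coordinate that \<open>\<phi>\<close> does not read averages
  \<open>r\<close> equal terms.\<close>

lemma iter_avg_restrict:
  assumes "\<And>g g'. (\<forall>i\<in>I. g i = g' i) \<Longrightarrow> \<phi> g = \<phi> g'" "r \<ge> 1"
    and "\<forall>i\<in>I. g i = g' i"
  shows "iter_avg r is \<phi> g = iter_avg r (filter (\<lambda>i. i \<in> I) is) \<phi> g'"
  using assms(3)
proof (induction "is" arbitrary: g g')
  case (Cons i "is")
  show ?case
  proof (cases "i \<in> I")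
    case True
    have "iter_avg r is \<phi> (g(i := c)) = iter_avg r (filter (\<lambda>i. i \<in> I) is) \<phi> (g'(i := c))" for c
      using Cons.prems by (intro Cons.IH) auto
    thus ?thesis using True by simp
  next
    case False
    have "iter_avg r is \<phi> (g(i := c)) = iter_avg r (filter (\<lambda>i. i \<in> I) is) \<phi> g'" for c
      using Cons.prems False by (intro Cons.IH) auto
    thus ?thesis using False assms(2) by simp
  qed
qed (use assms in auto)

text \<open>Since \<open>p\<close> permutes the range of each draw, every sum over \<open>c\<close>
  can be reindexed by \<open>p\<close>, and composition with \<open>p\<close> then passes through
  the point update.\<close>

lemma iter_avg_permute:
  assumes "p permutes {..<r}" "\<And>g. \<phi> (p \<circ> g) = \<phi> g"
  shows "iter_avg r is \<phi> (p \<circ> g) = iter_avg r is \<phi> g"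
proof (induction "is" arbitrary: g)
  case (Cons i "is")
  have "(\<Sum>c<r. iter_avg r is \<phi> ((p \<circ> g)(i := c))) = (\<Sum>c<r. iter_avg r is \<phi> ((p \<circ> g)(i := p c)))"
    using sum.permute[OF assms(1), of "\<lambda>c. iter_avg r is \<phi> ((p \<circ> g)(i := c))"] by simp
  also have "\<dots> = (\<Sum>c<r. iter_avg r is \<phi> (p \<circ> (g(i := c))))"
    by (intro sum.cong refl arg_cong[where f = "iter_avg r is \<phi>"]) auto
  also have "\<dots> = (\<Sum>c<r. iter_avg r is \<phi> (g(i := c)))" by (simp only: Cons)
  finally show ?case by (simp only: iter_avg.simps)
qed (use assms in simp)

text \<open>By invariance of \<open>\<phi>\<close>, every value not used so far may be replaced by the least unused
  one, \<open>b\<close>. So the coordinate averaged next repeats one of \<open>b\<close> old values, each with probability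
  \<open>1 / r\<close>, or takes the value \<open>b\<close> with probability \<open>1 - b / r\<close>.\<close>

lemma iter_avg_poly:
  assumes inv: "\<And>p g. p permutes {..<m} \<Longrightarrow> \<phi> (p \<circ> g) = \<phi> g"
  assumes "distinct is" "\<forall>j. g j < b" "b \<ge> 1"
  shows "\<exists>P :: complex poly. degree P \<le> length is \<and>
     (\<forall>r. b \<le> r \<and> r \<le> m \<longrightarrow> iter_avg r is \<phi> g = poly P (1 / of_nat r)) \<and>
     (\<exists>h. poly P 0 = \<phi> h \<and> inj_on h (set is) \<and> h ` set is \<subseteq> {b..<b + length is} \<and> (\<forall>i. i \<notin> set is \<longrightarrow> h i = g i))"
  using assms(2-)
proof (induction "is" arbitrary: g b)
  case Nil
  show ?case by (rule exI[of _ "[:\<phi> g:]"]) auto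
next
  case (Cons i "is")
  let ?ok = "\<lambda>g b P. degree P \<le> length is \<and>
     (\<forall>r. b \<le> r \<and> r \<le> m \<longrightarrow> iter_avg r is \<phi> g = poly P (1 / of_nat r)) \<and>
     (\<exists>h. poly P 0 = \<phi> h \<and> inj_on h (set is) \<and> h ` set is \<subseteq> {b..<b + length is} \<and> (\<forall>i. i \<notin> set is \<longrightarrow> h i = g i))"
  have "\<exists>P. ?ok (g(i := c)) b P" if "c < b" for c
    using Cons.prems that by (intro Cons.IH) auto
  then obtain Q where Q: "\<And>c. c < b \<Longrightarrow> ?ok (g(i := c)) b (Q c)" by metis
  have "\<exists>P. ?ok (g(i := b)) (Suc b) P"
    using Cons.prems by (intro Cons.IH) (auto simp: less_Suc_eq)
  then obtain N where N: "?ok (g(i := b)) (Suc b) N" by blast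
  then obtain h where h: "poly N 0 = \<phi> h" "inj_on h (set is)"
    "h ` set is \<subseteq> {Suc b..<Suc b + length is}" "\<forall>j. j \<notin> set is \<longrightarrow> h j = (g(i := b)) j" by blast
  define P where "P = [:0, 1:] * (\<Sum>c<b. Q c) + [:1, - of_nat b:] * N"
  have "degree (\<Sum>c<b. Q c) \<le> length is" using Q by (intro degree_sum_le) auto
  moreover have "degree [:0, 1 :: complex:] \<le> 1" "degree [:1, - of_nat b :: complex:] \<le> 1" by auto
  ultimately have "degree P \<le> 1 + length is"
    unfolding P_def using N by (intro degree_add_le order_trans[OF degree_mult_le] add_mono) auto
  moreover have "iter_avg r (i # is) \<phi> g = poly P (1 / of_nat r)" if r: "b \<le> r" "r \<le> m" for r
  proof -
    have r0: "r > 0" using r Cons.prems by simp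
    have new: "iter_avg r is \<phi> (g(i := c)) = poly N (1 / of_nat r)" if c: "c \<in> {b..<r}" for c
    proof -
      define p where "p = Transposition.transpose b c"
      have p: "p permutes {..<r}" using c unfolding p_def by (intro permutes_swap_id) auto
      have "p permutes {..<m}" using p r by (meson lessThan_subset_iff permutes_subset)
      \<comment> \<open>All values of \<open>g\<close> lie below \<open>b\<close>, so the
        transposition moves only the value at \<open>i\<close>.\<close>
      moreover have "g(i := c) = p \<circ> (g(i := b))"
      proof
        fix j show "(g(i := c)) j = (p \<circ> (g(i := b))) j"
          using Cons.prems(2)[rule_format, of j] c by (auto simp: p_def Transposition.transpose_def)
      qed
      ultimately have "iter_avg r is \<phi> (g(i := c)) = iter_avg r is \<phi> (g(i := b))"
        using iter_avg_permute[OF p, of \<phi> "is" "g(i := b)"] inv by simp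
      also have "\<dots> = poly N (1 / of_nat r)" using N c r by auto
      finally show ?thesis .
    qed
    have split: "{..<r} = {..<b} \<union> {b..<r}" using r by auto
    have "(\<Sum>c<r. iter_avg r is \<phi> (g(i := c))) =
        (\<Sum>c<b. iter_avg r is \<phi> (g(i := c))) + (\<Sum>c=b..<r. iter_avg r is \<phi> (g(i := c)))"
      unfolding split by (intro sum.union_disjoint) auto
    also have "\<dots> = (\<Sum>c<b. poly (Q c) (1 / of_nat r)) + of_nat (r - b) * poly N (1 / of_nat r)"
      using new Q r by (intro arg_cong2[where f = "(+)"]) auto
    finally show ?thesis using r r0
      by (simp add: P_def poly_sum of_nat_diff field_simps)
  qed
  \<comment> \<open>At 0 the repeated values have weight 0 and the fresh value has weight 1. Only
    fresh values survive, which is why \<open>h\<close> is injective on the drawn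
    coordinates.\<close>
  moreover have "poly P 0 = \<phi> h" using h by (simp add: P_def)
  moreover have "h i = b" using Cons.prems h(4) by auto
  moreover have "inj_on h (set (i # is))" using h(2,3) \<open>h i = b\<close> by fastforce
  moreover have "h ` set (i # is) \<subseteq> {b..<b + length (i # is)}" using h(3) \<open>h i = b\<close> by fastforce
  moreover have "\<forall>j. j \<notin> set (i # is) \<longrightarrow> h j = g j" using h(4) by auto
  ultimately show ?case by (intro exI[of _ P] conjI allI impI exI[of _ h]) (auto simp del: iter_avg.simps)
qed

text \<open>Only the coordinates in \<open>I\<close> matter, so the degree is bounded by
  \<open>card I\<close> instead of \<open>m\<close>. The fresh values are
  \<open>1, ..., card I\<close>, all below \<open>m\<close> since \<open>d < m\<close>; the
  injection they form on \<open>I\<close> extends to a permutation, which invariance turns into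
  \<open>id\<close>.\<close>

lemma iter_avg_poly_local:
  assumes inv: "\<And>p g. p permutes {..<m} \<Longrightarrow> \<phi> (p \<circ> g) = \<phi> g"
    and loc: "\<And>g g'. (\<forall>i\<in>I. g i = g' i) \<Longrightarrow> \<phi> g = \<phi> g'"
    and I: "I \<subseteq> {..<m}" "card I \<le> d" "d < m"
  shows "\<exists>P :: complex poly. degree P \<le> d \<and>
     (\<forall>r. 1 \<le> r \<and> r \<le> m \<longrightarrow> iter_avg r [0..<m] \<phi> (\<lambda>_. 0) = poly P (1 / of_nat r)) \<and>
     poly P 0 = \<phi> id"
proof -
  define xs where "xs = filter (\<lambda>i. i \<in> I) [0..<m]"
  have xs: "distinct xs" "set xs = I" using I by (auto simp: xs_def)
  hence len: "length xs = card I" using distinct_card by fastforce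
  obtain P h where P: "degree P \<le> length xs"
     "\<And>r. 1 \<le> r \<Longrightarrow> r \<le> m \<Longrightarrow> iter_avg r xs \<phi> (\<lambda>_. 0) = poly P (1 / of_nat r)"
     and h: "poly P 0 = \<phi> h" "inj_on h I" "h ` I \<subseteq> {1..<1 + length xs}"
  proof -
    have "\<exists>P. degree P \<le> length xs \<and>
       (\<forall>r. 1 \<le> r \<and> r \<le> m \<longrightarrow> iter_avg r xs \<phi> (\<lambda>_. 0) = poly P (1 / of_nat r)) \<and>
       (\<exists>h. poly P 0 = \<phi> h \<and> inj_on h (set xs) \<and> h ` set xs \<subseteq> {1..<1 + length xs} \<and>
          (\<forall>i. i \<notin> set xs \<longrightarrow> h i = 0))"
      by (rule iter_avg_poly) (auto intro: inv xs)
    thus thesis using that xs(2) by blast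
  qed
  have "h ` I \<subseteq> {..<m}" using h(3) len I by fastforce
  then obtain p where p: "p permutes {..<m}" "\<forall>i\<in>I. p i = h i"
    using exists_permutation_extending[of "{..<m}" I h] I h(2) by auto
  have "\<phi> h = \<phi> (p \<circ> id)" using p by (intro loc) auto
  also have "\<dots> = \<phi> id" using p inv by blast
  finally have "poly P 0 = \<phi> id" using h by simp
  moreover have "iter_avg r [0..<m] \<phi> (\<lambda>_. 0) = poly P (1 / of_nat r)" if "1 \<le> r" "r \<le> m" for r
  proof -
    have "iter_avg r [0..<m] \<phi> (\<lambda>_. 0) = iter_avg r xs \<phi> (\<lambda>_. 0)"
      unfolding xs_def by (rule iter_avg_restrict) (use loc that in auto)
    thus ?thesis using P(2)[OF that] by simp
  qed
  ultimately show ?thesis using P(1) len I by (intro exI[of _ P]) auto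
qed

section \<open>Acceptance probability as a polynomial\<close>

lemma mat_adjoint_mult_index:
  fixes U :: "complex mat"
  assumes "U \<in> carrier_mat n n" "k < n" "j < n"
  shows "(mat_adjoint U * U) $$ (k, j) = (\<Sum>i<n. cnj (U $$ (i, k)) * U $$ (i, j))"
  using assms by (simp add: mat_adjoint_def scalar_prod_def mat_of_rows_def conjugate_complex_def atLeast0LessThan)

lemma unitary_mat_preserves_norm:
  assumes U: "unitary_mat n U" and v: "v \<in> carrier_vec n"
  shows "(\<Sum>i<n. (cmod ((U *\<^sub>v v) $ i))\<^sup>2) = (\<Sum>i<n. (cmod (v $ i))\<^sup>2)"
proof -
  have Uc: "U \<in> carrier_mat n n" and U1: "mat_adjoint U * U = 1\<^sub>m n"
    using U by (auto simp: unitary_mat_def)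
  have Uv: "(U *\<^sub>v v) $ i = (\<Sum>j<n. U $$ (i, j) * v $ j)" if "i < n" for i
    using that Uc v by (simp add: scalar_prod_def atLeast0LessThan)
  have orth: "(\<Sum>i<n. cnj (U $$ (i, k)) * U $$ (i, j)) = (if k = j then 1 else 0)" if "k < n" "j < n" for k j
    using mat_adjoint_mult_index[OF Uc that] that by (simp add: U1)
  have "complex_of_real (\<Sum>i<n. (cmod ((U *\<^sub>v v) $ i))\<^sup>2) =
      (\<Sum>i<n. (\<Sum>j<n. U $$ (i, j) * v $ j) * cnj (\<Sum>k<n. U $$ (i, k) * v $ k))"
    by (simp add: Uv complex_norm_square del: cnj_sum of_real_power)
  also have "\<dots> = (\<Sum>i<n. \<Sum>j<n. \<Sum>k<n. v $ j * cnj (v $ k) * (cnj (U $$ (i, k)) * U $$ (i, j)))"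
    by (simp add: sum_product mult_ac)
  also have "\<dots> = (\<Sum>j<n. \<Sum>i<n. \<Sum>k<n. v $ j * cnj (v $ k) * (cnj (U $$ (i, k)) * U $$ (i, j)))"
    by (rule sum.swap)
  also have "\<dots> = (\<Sum>j<n. \<Sum>k<n. v $ j * cnj (v $ k) * (\<Sum>i<n. cnj (U $$ (i, k)) * U $$ (i, j)))"
    unfolding sum_distrib_left by (intro sum.cong refl sum.swap)
  also have "\<dots> = (\<Sum>j<n. \<Sum>k<n. if k = j then v $ j * cnj (v $ k) else 0)"
    by (intro sum.cong refl) (simp add: orth)
  also have "\<dots> = (\<Sum>j<n. v $ j * cnj (v $ j))" by simp
  also have "\<dots> = complex_of_real (\<Sum>i<n. (cmod (v $ i))\<^sup>2)"
    by (simp add: complex_norm_square del: of_real_power)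
  finally show ?thesis by (simp only: of_real_eq_iff)
qed

lemma phase_oracle_mult_index:
  assumes "v \<in> carrier_vec (2 ^ N * W)" "i < 2 ^ N * W"
  shows "(phase_oracle N W f *\<^sub>v v) $ i = (if f (i div W) then - 1 else 1) * v $ i"
proof -
  have "(phase_oracle N W f *\<^sub>v v) $ i =
      (\<Sum>j<2 ^ N * W. (if i = j then (if f (i div W) then - 1 else 1) else 0) * v $ j)"
    using assms by (simp add: phase_oracle_def scalar_prod_def atLeast0LessThan)
  also have "\<dots> = (\<Sum>j<2 ^ N * W. if i = j then (if f (i div W) then - 1 else 1) * v $ j else 0)"
    by (intro sum.cong) auto
  finally show ?thesis using assms(2) by simp
qed

lemma phase_oracle_mult_carrier:
  "phase_oracle N (workspace_dim A) f *\<^sub>v v \<in> carrier_vec (state_dim N A)"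
  by (simp add: phase_oracle_def state_dim_def carrier_vecI)

lemma state_after_carrier:
  assumes "valid_algorithm N A" "t \<le> queries A"
  shows "state_after N A f t \<in> carrier_vec (state_dim N A)"
proof -
  have "unitaries A t \<in> carrier_mat (state_dim N A) (state_dim N A)"
    using assms by (auto simp: valid_algorithm_def unitary_mat_def)
  thus ?thesis by (cases t) (auto intro!: mult_mat_vec_carrier[OF _ phase_oracle_mult_carrier])
qed

lemma state_after_norm:
  assumes A: "valid_algorithm N A" and "t \<le> queries A"
  shows "(\<Sum>i<state_dim N A. (cmod (state_after N A f t $ i))\<^sup>2) = 1"
  using assms(2)
proof (induction t)
  case 0
  have "state_dim N A > 0" using A by (simp add: valid_algorithm_def state_dim_def)
  moreover have "(\<Sum>i<state_dim N A. (cmod (unit_vec (state_dim N A) 0 $ i))\<^sup>2) =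
      (\<Sum>i<state_dim N A. if i = 0 then 1 else 0)"
    by (intro sum.cong) auto
  moreover have "unitary_mat (state_dim N A) (unitaries A 0)" using A by (simp add: valid_algorithm_def)
  ultimately show ?case by (simp add: unitary_mat_preserves_norm)
next
  case (Suc t)
  have U: "unitary_mat (state_dim N A) (unitaries A (Suc t))"
    using A Suc.prems by (simp add: valid_algorithm_def)
  have "(\<Sum>i<state_dim N A. (cmod (state_after N A f (Suc t) $ i))\<^sup>2) =
     (\<Sum>i<state_dim N A. (cmod ((phase_oracle N (workspace_dim A) f *\<^sub>v state_after N A f t) $ i))\<^sup>2)"
    using unitary_mat_preserves_norm[OF U phase_oracle_mult_carrier] by simp
  also have "\<dots> = (\<Sum>i<state_dim N A. (cmod (state_after N A f t $ i))\<^sup>2)"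
    using state_after_carrier[OF A, of t f] Suc.prems
    by (intro sum.cong refl) (simp add: phase_oracle_mult_index state_dim_def norm_mult)
  finally show ?case using Suc by simp
qed

lemma accept_prob_bounds:
  assumes A: "valid_algorithm N A"
  shows "accept_prob N A f + reject_prob N A f = 1" "0 \<le> accept_prob N A f" "0 \<le> reject_prob N A f"
proof -
  have "accepting A \<subseteq> {..<state_dim N A}" using A by (simp add: valid_algorithm_def)
  thus "accept_prob N A f + reject_prob N A f = 1"
    using state_after_norm[OF A order_refl, of f]
    unfolding accept_prob_def reject_prob_def outcome_prob_def
    by (subst add.commute, subst sum.subset_diff[symmetric]) auto
qed (auto simp: accept_prob_def reject_prob_def outcome_prob_def intro!: sum_nonneg)

section \<open>Polynomials in the signs of the function values\<close>

text \<open>Polynomials of degree at most \<open>d\<close> in the signs of \<open>f\<close> at the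
  inputs below \<open>M\<close>. The inductive form reduces statements linear in the polynomial to
  monomials; since \<open>zs\<close> may repeat inputs, multiplying monomials is list
  concatenation.\<close>

inductive sign_poly :: "nat \<Rightarrow> nat \<Rightarrow> ((nat \<Rightarrow> bool) \<Rightarrow> complex) \<Rightarrow> bool" for M where
  monomial: "length zs \<le> d \<Longrightarrow> set zs \<subseteq> {..<M} \<Longrightarrow>
      sign_poly M d (\<lambda>f. prod_list (map (\<lambda>z. if f z then - 1 else 1) zs))"
| scale: "sign_poly M d F \<Longrightarrow> sign_poly M d (\<lambda>f. a * F f)"
| add: "sign_poly M d F \<Longrightarrow> sign_poly M d G \<Longrightarrow> sign_poly M d (\<lambda>f. F f + G f)"

lemma sign_poly_const: "sign_poly M d (\<lambda>_. a)"
  using scale[OF monomial[of "[]" d M], of a] by simp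

lemma sign_poly_sum: "(\<And>i. i \<in> S \<Longrightarrow> sign_poly M d (F i)) \<Longrightarrow> sign_poly M d (\<lambda>f. \<Sum>i\<in>S. F i f)"
proof (induction S rule: infinite_finite_induct)
  case (insert i S)
  thus ?case by (simp add: sign_poly.add)
qed (simp_all add: sign_poly_const)

lemma sign_poly_mult:
  assumes "sign_poly M d F" "sign_poly M e G"
  shows "sign_poly M (d + e) (\<lambda>f. F f * G f)"
  using assms(1)
proof induction
  case (monomial zs d)
  show ?case using assms(2)
  proof induction
    case (monomial ys e)
    have "sign_poly M (d + e) (\<lambda>f. prod_list (map (\<lambda>z. if f z then - 1 else 1) (zs @ ys)))"
      using monomial \<open>length zs \<le> d\<close> \<open>set zs \<subseteq> {..<M}\<close> by (intro sign_poly.monomial) auto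
    thus ?case by simp
  next
    case (scale e G a)
    thus ?case using sign_poly.scale[of M "d + e" _ a] by (simp add: mult_ac)
  next
    case (add e G H)
    thus ?case using sign_poly.add[OF add.IH] by (simp add: distrib_left)
  qed
next
  case (scale d F a)
  thus ?case using sign_poly.scale[OF scale.IH, of a] by (simp add: mult_ac)
next
  case (add d F H)
  thus ?case using sign_poly.add[OF add.IH] by (simp add: distrib_right)
qed

lemma sign_poly_cnj: "sign_poly M d F \<Longrightarrow> sign_poly M d (\<lambda>f. cnj (F f))"
proof (induction rule: sign_poly.induct)
  case (monomial zs d)
  have "cnj (prod_list (map (\<lambda>z. if f z then - 1 else 1) zs)) = prod_list (map (\<lambda>z. if f z then - 1 else 1) zs)" for f
    by (induction zs) auto
  thus ?case using sign_poly.monomial[OF monomial] by simp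
qed (auto intro: sign_poly.scale sign_poly.add)

text \<open>The polynomial method: a query multiplies each amplitude by a single sign, raising the
  degree by one, and a unitary only forms linear combinations.\<close>

lemma sign_poly_state_after:
  assumes A: "valid_algorithm N A" and "t \<le> queries A" "i < state_dim N A"
  shows "sign_poly (2 ^ N) t (\<lambda>f. state_after N A f t $ i)"
  using assms(2,3)
proof (induction t arbitrary: i)
  case 0
  show ?case by (simp add: sign_poly_const)
next
  case (Suc t)
  let ?n = "state_dim N A" and ?W = "workspace_dim A"
  have U: "unitaries A (Suc t) \<in> carrier_mat ?n ?n"
    using A Suc.prems by (auto simp: valid_algorithm_def unitary_mat_def)
  have eq: "state_after N A f (Suc t) $ i = (\<Sum>j<?n. unitaries A (Suc t) $$ (i, j) *
      ((if f (j div ?W) then - 1 else 1) * state_after N A f t $ j))" for f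
  proof -
    let ?v = "phase_oracle N ?W f *\<^sub>v state_after N A f t"
    have v: "?v \<in> carrier_vec ?n" by (rule phase_oracle_mult_carrier)
    have "(unitaries A (Suc t) *\<^sub>v v) $ i = (\<Sum>j<?n. unitaries A (Suc t) $$ (i, j) * v $ j)"
      if "v \<in> carrier_vec ?n" for v
      using that U Suc.prems by (simp add: scalar_prod_def atLeast0LessThan)
    from this[OF v]
    have "state_after N A f (Suc t) $ i = (\<Sum>j<?n. unitaries A (Suc t) $$ (i, j) * ?v $ j)"
      by simp
    also have "\<dots> = (\<Sum>j<?n. unitaries A (Suc t) $$ (i, j) *
        ((if f (j div ?W) then - 1 else 1) * state_after N A f t $ j))"
      using state_after_carrier[OF A, of t f] Suc.prems
      by (intro sum.cong refl) (simp add: phase_oracle_mult_index state_dim_def)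
    finally show ?thesis .
  qed
  have "sign_poly (2 ^ N) (Suc t) (\<lambda>f. \<Sum>j<?n. unitaries A (Suc t) $$ (i, j) *
      ((if f (j div ?W) then - 1 else 1) * state_after N A f t $ j))"
  proof (intro sign_poly_sum sign_poly.scale)
    fix j assume j: "j \<in> {..<?n}"
    have "j div ?W < 2 ^ N" using j by (simp add: state_dim_def less_mult_imp_div_less)
    hence "sign_poly (2 ^ N) 1 (\<lambda>f. if f (j div ?W) then - 1 else 1)"
      using sign_poly.monomial[of "[j div ?W]" 1 "2 ^ N"] by simp
    from sign_poly_mult[OF this Suc.IH[of j]]
    show "sign_poly (2 ^ N) (Suc t) (\<lambda>f. (if f (j div ?W) then - 1 else 1) * state_after N A f t $ j)"
      using j Suc.prems by simp
  qed
  thus ?case by (simp only: eq)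
qed

text \<open>A squared modulus is an amplitude times its conjugate, which doubles the degree.\<close>

lemma sign_poly_accept_prob:
  assumes A: "valid_algorithm N A"
  shows "sign_poly (2 ^ N) (2 * queries A) (\<lambda>f. complex_of_real (accept_prob N A f))"
proof -
  have "sign_poly (2 ^ N) (queries A + queries A) (\<lambda>f. \<Sum>i\<in>accepting A.
      state_after N A f (queries A) $ i * cnj (state_after N A f (queries A) $ i))"
    using A by (intro sign_poly_sum sign_poly_mult sign_poly_cnj sign_poly_state_after)
      (auto simp: valid_algorithm_def)
  thus ?thesis
    by (simp add: accept_prob_def outcome_prob_def complex_norm_square mult_2 del: of_real_power)
qed

section \<open>Addressing functions\<close>

text \<open>The low \<open>m\<close> digits of \<open>z\<close> hold the data \<open>x\<close>, and
  \<open>z div 2 ^ m\<close> is the address.\<close>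

definition addressing :: "nat \<Rightarrow> (nat \<Rightarrow> nat) \<Rightarrow> nat \<Rightarrow> bool" where
  "addressing m g z \<longleftrightarrow> bit z (g (z div 2 ^ m))"

lemma flip_bit_less_exp: "z < 2 ^ n \<Longrightarrow> i < n \<Longrightarrow> flip_bit i z < (2 ^ n :: nat)"
  by (metis leD take_bit_flip_bit_eq take_bit_nat_eq_self_iff)

lemma flip_bit_div_exp: "i < m \<Longrightarrow> flip_bit i z div 2 ^ m = (z div 2 ^ m :: nat)"
  unfolding drop_bit_eq_div[symmetric] by (rule bit_eqI) (auto simp: bit_simps)

lemma flip_bit_flip_bit [simp]: "flip_bit i (flip_bit i z) = (z :: nat)"
  by (rule bit_eqI) (auto simp: bit_simps)

text \<open>The \<open>l\<close> address digits select the position, and the position lies in the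
  range of \<open>g\<close>; together these form the relevant set \<open>J\<close>.\<close>

lemma junta_addressing:
  assumes m: "m = 2 ^ l" and g: "\<forall>i<m. g i < m" and card: "card (g ` {..<m}) + l \<le> k"
  shows "junta (m + l) k (addressing m g)"
proof -
  define J where "J = g ` {..<m} \<union> {m..<m + l}"
  have "J \<subseteq> {..<m + l}" using g by (auto simp: J_def intro: trans_less_add1)
  moreover have "card J \<le> k"
    using card_Un_le[of "g ` {..<m}" "{m..<m + l}"] card by (simp add: J_def)
  moreover have "addressing m g x = addressing m g y"
    if "x < 2 ^ (m + l)" "y < 2 ^ (m + l)" "\<forall>i\<in>J. bit x i = bit y i" for x y
  proof -
    have high: "\<not> bit z (m + j)" if "z < 2 ^ (m + l)" "j \<ge> l" for z j :: nat
      using that by (metis add_le_cancel_left bit_take_bit_iff leD take_bit_nat_eq_self_iff)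
    have eq: "x div 2 ^ m = y div 2 ^ m"
      unfolding drop_bit_eq_div[symmetric]
    proof (rule bit_eqI)
      fix j show "bit (drop_bit m x) j = bit (drop_bit m y) j"
        using that high[of x j] high[of y j] by (cases "j < l") (auto simp: bit_drop_bit_eq J_def)
    qed
    have "x div 2 ^ m < m" using that(1) unfolding m by (simp add: less_mult_imp_div_less power_add mult.commute)
    thus ?thesis using that(3) eq by (auto simp: addressing_def J_def)
  qed
  ultimately show ?thesis unfolding junta_def by blast
qed

text \<open>On the set \<open>B\<close> of inputs whose selected digit lies outside
  \<open>J\<close>, flipping that digit changes the addressing function but not \<open>h\<close>, so
  \<open>h\<close> errs on exactly half of \<open>B\<close>. As \<open>s\<close> is injective and
  \<open>card J \<le> m / 2\<close>, \<open>B\<close> contains at least half of all inputs; the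
  distance is thus at least \<open>1 / 4\<close>.\<close>

lemma far_addressing:
  assumes m: "m = 2 ^ l" and k: "2 * k \<le> m" and s: "s permutes {..<m}"
  shows "far_from_juntas (1 / 5) (m + l) k (addressing m s)"
  unfolding far_from_juntas_def
proof (intro allI impI)
  fix h assume "junta (m + l) k h"
  then obtain J where J: "J \<subseteq> {..<m + l}" "card J \<le> k"
    "\<And>x y. x < 2 ^ (m + l) \<Longrightarrow> y < 2 ^ (m + l) \<Longrightarrow> (\<forall>i\<in>J. bit x i = bit y i) \<Longrightarrow> h x = h y"
    unfolding junta_def by blast
  let ?f = "addressing m s"
  define B where "B = {z. z < 2 ^ (m + l) \<and> s (z div 2 ^ m) \<notin> J}"
  define E where "E = {z. z < 2 ^ (m + l) \<and> ?f z \<noteq> h z}"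
  define \<psi> where "\<psi> z = flip_bit (s (z div 2 ^ m)) z" for z :: nat
  have fin: "finite B" "finite E" by (auto simp: B_def E_def)
  have addr: "s (z div 2 ^ m) < m" if "z < 2 ^ (m + l)" for z
  proof -
    have "z div 2 ^ m < m" using that by (subst m) (simp add: less_mult_imp_div_less power_add mult.commute)
    thus ?thesis using permutes_in_image[OF s] by simp
  qed
  have \<psi>: "\<psi> z \<in> B" "\<psi> (\<psi> z) = z" "?f (\<psi> z) = (\<not> ?f z)" "h (\<psi> z) = h z" if "z \<in> B" for z
  proof -
    have z: "z < 2 ^ (m + l)" "s (z div 2 ^ m) \<notin> J" using that by (auto simp: B_def)
    have div: "\<psi> z div 2 ^ m = z div 2 ^ m"
      unfolding \<psi>_def using addr[OF z(1)] by (rule flip_bit_div_exp)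
    have lt: "\<psi> z < 2 ^ (m + l)"
      unfolding \<psi>_def using z addr[OF z(1)] by (intro flip_bit_less_exp) auto
    show "\<psi> z \<in> B" using lt div z by (simp add: B_def)
    show "\<psi> (\<psi> z) = z" unfolding \<psi>_def[of "\<psi> z"] div by (simp add: \<psi>_def)
    show "?f (\<psi> z) = (\<not> ?f z)" unfolding addressing_def div by (simp add: \<psi>_def bit_flip_bit_iff)
    show "h (\<psi> z) = h z"
      using lt z by (intro J(3)) (auto simp: \<psi>_def bit_flip_bit_iff)
  qed
  \<comment> \<open>The involution \<open>\<psi>\<close> preserves the address, hence also
    \<open>B\<close>, and exchanges errors with agreements.\<close>
  have "bij_betw \<psi> (B \<inter> E) (B - E)"
    by (rule bij_betw_byWitness[of _ \<psi>]) (use \<psi> in \<open>auto simp: E_def B_def\<close>)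
  hence "card (B \<inter> E) = card (B - E)" by (rule bij_betw_same_card)
  moreover have "card B = card (B \<inter> E) + card (B - E)"
    using fin by (metis Int_Diff_Un Int_Diff_disjoint card_Un_disjoint finite_Diff finite_Int)
  moreover have "card (B \<inter> E) \<le> card E" using fin by (intro card_mono) auto
  ultimately have BE: "card B \<le> 2 * card E" by simp
  define I where "I = {i. i < m \<and> s i \<notin> J}"
  have "card {i. i < m \<and> s i \<in> J} \<le> card J"
    using J(1) inj_on_subset[OF permutes_inj[OF s]]
    by (intro card_inj_on_le[of s]) (auto intro: finite_subset)
  moreover have "card {..<m} = card I + card {i. i < m \<and> s i \<in> J}"
  proof -
    have "{..<m} = I \<union> {i. i < m \<and> s i \<in> J}" by (auto simp: I_def)
    moreover have "card (I \<union> {i. i < m \<and> s i \<in> J}) = card I + card {i. i < m \<and> s i \<in> J}"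
      by (rule card_Un_disjoint) (auto simp: I_def)
    ultimately show ?thesis by simp
  qed
  ultimately have I: "m \<le> 2 * card I" using J(2) k by simp
  \<comment> \<open>Each address in \<open>I\<close> contributes all its \<open>2 ^ m\<close> data
    words to \<open>B\<close>.\<close>
  have "card (I \<times> {..<2 ^ m :: nat}) \<le> card B"
  proof (rule card_inj_on_le)
    show "inj_on (\<lambda>(i, x). i * 2 ^ m + x) (I \<times> {..<2 ^ m})"
    proof (rule inj_onI, clarsimp)
      fix i j x y :: nat assume *: "x < 2 ^ m" "y < 2 ^ m" "i * 2 ^ m + x = j * 2 ^ m + y"
      have "(i * 2 ^ m + x) div 2 ^ m = i" "(j * 2 ^ m + y) div 2 ^ m = j" using *(1,2) by auto
      hence "i = j" using *(3) by metis
      thus "i = j \<and> x = y" using *(3) by simp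
    qed
    show "(\<lambda>(i, x). i * 2 ^ m + x) ` (I \<times> {..<2 ^ m}) \<subseteq> B"
    proof clarsimp
      fix i x :: nat assume *: "i \<in> I" "x < 2 ^ m"
      have "i * 2 ^ m + x < Suc i * 2 ^ m" using * by simp
      also have "\<dots> \<le> 2 ^ l * 2 ^ m" using * m by (intro mult_right_mono) (auto simp: I_def)
      finally show "i * 2 ^ m + x \<in> B" using * by (simp add: B_def I_def power_add mult.commute)
    qed
  qed (rule fin)
  hence "card I * 2 ^ m \<le> card B" by (simp add: card_cartesian_product)
  hence "m * 2 ^ m \<le> 4 * card E" using BE mult_right_mono[OF I, of "2 ^ m"] by linarith
  hence "2 ^ (m + l) \<le> 4 * card E" using m by (simp add: power_add mult.commute)
  hence "(2 :: real) ^ (m + l) \<le> 4 * real (card E)"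
    by (metis of_nat_le_iff of_nat_mult of_nat_numeral of_nat_power)
  thus "1 / 5 \<le> bool_dist (m + l) ?f h"
    unfolding bool_dist_def E_def[symmetric] by (simp add: pos_le_divide_eq)
qed

section \<open>Averaging over relabelled addressing functions\<close>

text \<open>Averaging over all \<open>s\<close> makes the result invariant under composing
  \<open>g\<close> with a permutation of \<open>{..<m}\<close> on the left, the symmetry on which
  \<open>iter_avg_poly\<close> rests.\<close>

definition perm_avg :: "nat \<Rightarrow> ((nat \<Rightarrow> bool) \<Rightarrow> complex) \<Rightarrow> (nat \<Rightarrow> nat) \<Rightarrow> complex" where
  "perm_avg m F g = (\<Sum>s | s permutes {..<m}. F (addressing m (s \<circ> g))) / fact m"

lemma perm_avg_permute:
  assumes "p permutes {..<m}" shows "perm_avg m F (p \<circ> g) = perm_avg m F g"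
  using sum_permutations_compose_right[OF assms, of "\<lambda>s. F (addressing m (s \<circ> g))"]
  by (simp add: perm_avg_def comp_assoc)

lemma perm_avg_real:
  assumes "\<And>s. s permutes {..<m} \<Longrightarrow> F (addressing m (s \<circ> g)) = of_real (a s) \<and> lo \<le> a s \<and> a s \<le> hi"
  shows "perm_avg m F g \<in> \<real> \<and> lo \<le> Re (perm_avg m F g) \<and> Re (perm_avg m F g) \<le> hi"
proof -
  let ?S = "{s. s permutes {..<m}}"
  have eq: "perm_avg m F g = of_real ((\<Sum>s\<in>?S. a s) / fact m)"
    using assms by (simp add: perm_avg_def)
  have card: "card ?S = fact m" by (simp add: card_permutations)
  have "fact m * lo \<le> (\<Sum>s\<in>?S. a s)"
    using sum_bounded_below[of ?S lo a] assms card by simp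
  moreover have "(\<Sum>s\<in>?S. a s) \<le> fact m * hi"
    using sum_bounded_above[of ?S a hi] assms card by simp
  ultimately show ?thesis unfolding eq
    by (simp add: pos_le_divide_eq pos_divide_le_eq mult.commute del: of_real_divide)
qed

text \<open>By linearity a monomial suffices. A product of at most \<open>d\<close> signs reads
  \<open>g\<close> only at the addresses of its inputs, hence at no more than \<open>d\<close>
  coordinates.\<close>

lemma sign_poly_iter_avg:
  assumes F: "sign_poly (2 ^ (m + l)) d F" and m: "m = 2 ^ l" and d: "d < m"
  shows "\<exists>P :: complex poly. degree P \<le> d \<and>
     (\<forall>r. 1 \<le> r \<and> r \<le> m \<longrightarrow> iter_avg r [0..<m] (perm_avg m F) (\<lambda>_. 0) = poly P (1 / of_nat r)) \<and>
     poly P 0 = perm_avg m F id"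
  using F d
proof induction
  case (monomial zs d)
  define I where "I = (\<lambda>z. z div 2 ^ m) ` set zs"
  have "I \<subseteq> {..<m}"
    using monomial(2) by (subst m) (auto simp: I_def power_add mult.commute intro!: less_mult_imp_div_less)
  moreover have "card I \<le> d"
    unfolding I_def using monomial(1) card_length[of zs]
    by (intro order_trans[OF card_image_le]) auto
  ultimately show ?case
  proof (intro iter_avg_poly_local[of m _ I])
    fix g g' :: "nat \<Rightarrow> nat" assume "\<forall>i\<in>I. g i = g' i"
    thus "perm_avg m (\<lambda>f. prod_list (map (\<lambda>z. if f z then - 1 else 1) zs)) g =
        perm_avg m (\<lambda>f. prod_list (map (\<lambda>z. if f z then - 1 else 1) zs)) g'"
      unfolding perm_avg_def
      by (intro arg_cong2[where f = "(/)"] sum.cong refl arg_cong[where f = prod_list] map_cong)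
        (auto simp: addressing_def I_def)
  qed (use monomial perm_avg_permute in \<open>simp_all del: comp_apply\<close>)
next
  case (scale d F a)
  then obtain P where P: "degree P \<le> d"
    "\<And>r. 1 \<le> r \<Longrightarrow> r \<le> m \<Longrightarrow> iter_avg r [0..<m] (perm_avg m F) (\<lambda>_. 0) = poly P (1 / of_nat r)"
    "poly P 0 = perm_avg m F id" by blast
  have "perm_avg m (\<lambda>f. a * F f) = (\<lambda>g. a * perm_avg m F g)"
    by (auto simp: perm_avg_def sum_distrib_left)
  thus ?case using P
    by (intro exI[of _ "smult a P"]) (auto simp: iter_avg_scale id_def intro: order_trans[OF degree_smult_le])
next
  case (add d F G)
  then obtain P Q where P: "degree P \<le> d"
    "\<And>r. 1 \<le> r \<Longrightarrow> r \<le> m \<Longrightarrow> iter_avg r [0..<m] (perm_avg m F) (\<lambda>_. 0) = poly P (1 / of_nat r)"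
    "poly P 0 = perm_avg m F id"
    and Q: "degree Q \<le> d"
    "\<And>r. 1 \<le> r \<Longrightarrow> r \<le> m \<Longrightarrow> iter_avg r [0..<m] (perm_avg m G) (\<lambda>_. 0) = poly Q (1 / of_nat r)"
    "poly Q 0 = perm_avg m G id" by blast
  have "perm_avg m (\<lambda>f. F f + G f) = (\<lambda>g. perm_avg m F g + perm_avg m G g)"
    by (auto simp: perm_avg_def sum.distrib add_divide_distrib)
  thus ?case using P Q
    by (intro exI[of _ "P + Q"]) (auto simp: iter_avg_add id_def intro: degree_add_le)
qed

text \<open>If \<open>r = k - l\<close> were too large for the number of queries, the averaged
  acceptance probability at \<open>1 / r\<close>, where all functions are juntas, would be within
  less than \<open>1 / 3\<close> of its value at 0, where all are far. The tester forces a gap of at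
  least \<open>1 / 3\<close>.\<close>

lemma junta_tester_queries:
  assumes tester: "junta_tester (1 / 5) (m + l) k A" and m: "m = 2 ^ l" and k: "2 * k \<le> m" and l: "l < k"
  shows "k - l < 1600 * (2 * queries A + 1) ^ 3"
proof (rule ccontr)
  \<comment> \<open>Of the \<open>k\<close> permitted relevant variables, \<open>l\<close> are spent
    on the address.\<close>
  define r where "r = k - l"
  define T where "T = queries A"
  define F where "F f = complex_of_real (accept_prob (m + l) A f)" for f
  assume "\<not> k - l < 1600 * (2 * queries A + 1) ^ 3"
  hence r: "r \<ge> 1600 * (2 * T + 1) ^ 3" by (simp add: r_def T_def)
  \<comment> \<open>Yields \<open>2 * T < r \<le> m\<close>, the degree condition of
    \<open>sign_poly_iter_avg\<close>.\<close>
  have "(2 * T + 1) ^ 1 \<le> (2 * T + 1) ^ 3" by (intro power_increasing) auto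
  hence rT: "r \<ge> 1" "2 * T < m" "r \<le> m" using r k by (auto simp: r_def)
  have valid: "valid_algorithm (m + l) A" using tester by (simp add: junta_tester_def)
  have sp: "sign_poly (2 ^ (m + l)) (2 * T) F"
    using sign_poly_accept_prob[OF valid] by (simp add: F_def[abs_def] T_def)
  obtain P where P: "degree P \<le> 2 * T"
    "\<And>r. 1 \<le> r \<Longrightarrow> r \<le> m \<Longrightarrow> iter_avg r [0..<m] (perm_avg m F) (\<lambda>_. 0) = poly P (1 / of_nat r)"
    "poly P 0 = perm_avg m F id"
    using sign_poly_iter_avg[OF sp m rT(2)] by blast
  define q where "q s = Re (iter_avg s [0..<m] (perm_avg m F) (\<lambda>_. 0))" for s
  have q: "poly P (1 / of_nat s) = of_real (q s) \<and> 0 \<le> q s \<and> q s \<le> 1" if "1 \<le> s" "s \<le> r" for s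
  proof -
    have "iter_avg s [0..<m] (perm_avg m F) (\<lambda>_. 0) \<in> \<real> \<and>
        0 \<le> Re (iter_avg s [0..<m] (perm_avg m F) (\<lambda>_. 0)) \<and>
        Re (iter_avg s [0..<m] (perm_avg m F) (\<lambda>_. 0)) \<le> 1"
      using that accept_prob_bounds[OF valid]
      by (intro iter_avg_real perm_avg_real) (auto simp: F_def intro: add_le_imp_le_right, smt (verit))
    thus ?thesis using P(2)[of s] that rT by (simp add: q_def of_real_Re)
  qed
  have juntas: "2 / 3 \<le> q r"
  proof -
    have "perm_avg m F h \<in> \<real> \<and> 2 / 3 \<le> Re (perm_avg m F h) \<and> Re (perm_avg m F h) \<le> 1"
      if h: "\<forall>i\<in>set [0..<m]. h i < r" for h
    proof (rule perm_avg_real)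
      fix s assume s: "s permutes {..<m}"
      have "card ((s \<circ> h) ` {..<m}) \<le> card (s ` {..<r})"
        using h by (intro card_mono) auto
      also have "\<dots> \<le> r" using card_image_le[of "{..<r}" s] by simp
      finally have "card ((s \<circ> h) ` {..<m}) + l \<le> k" using l by (simp add: r_def)
      moreover have "\<forall>i<m. (s \<circ> h) i < m"
      proof (intro allI impI)
        fix i assume "i < m"
        hence "h i \<in> {..<m}" using bspec[OF h, of i] rT(3) by simp
        hence "s (h i) \<in> {..<m}" by (simp only: permutes_in_image[OF s])
        thus "(s \<circ> h) i < m" by simp
      qed
      ultimately have "junta (m + l) k (addressing m (s \<circ> h))" using m by (intro junta_addressing)
      hence "2 / 3 \<le> accept_prob (m + l) A (addressing m (s \<circ> h))"
        using tester by (simp add: junta_tester_def)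
      moreover have "accept_prob (m + l) A (addressing m (s \<circ> h)) \<le> 1"
        using accept_prob_bounds[OF valid, of "addressing m (s \<circ> h)"] by simp
      ultimately show "F (addressing m (s \<circ> h)) = of_real (accept_prob (m + l) A (addressing m (s \<circ> h))) \<and>
          2 / 3 \<le> accept_prob (m + l) A (addressing m (s \<circ> h)) \<and> accept_prob (m + l) A (addressing m (s \<circ> h)) \<le> 1"
        by (simp add: F_def)
    qed
    thus ?thesis using iter_avg_real[OF rT(1), of "[0..<m]" "\<lambda>_. 0" "perm_avg m F" "2 / 3" 1]
      by (simp add: q_def)
  qed
  have far: "Re (perm_avg m F id) \<le> 1 / 3"
  proof -
    have "perm_avg m F id \<in> \<real> \<and> 0 \<le> Re (perm_avg m F id) \<and> Re (perm_avg m F id) \<le> 1 / 3"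
    proof (rule perm_avg_real)
      fix s assume s: "s permutes {..<m}"
      have "reject_prob (m + l) A (addressing m s) \<ge> 2 / 3"
        using tester far_addressing[OF m k s] by (simp add: junta_tester_def)
      thus "F (addressing m (s \<circ> id)) = of_real (accept_prob (m + l) A (addressing m s)) \<and>
          0 \<le> accept_prob (m + l) A (addressing m s) \<and> accept_prob (m + l) A (addressing m s) \<le> 1 / 3"
        using accept_prob_bounds[OF valid, of "addressing m s"] by (simp add: F_def)
    qed
    thus ?thesis by simp
  qed
  \<comment> \<open>The degree bound is relaxed to \<open>2 * T + 1\<close> so that it is positive
    even without queries.\<close>
  have "cmod (poly P 0 - of_real (q r)) < 1 / 3"
    using P(1) r q by (intro poly_inverse_nodes_close[of "2 * T + 1"]) auto
  hence "\<bar>Re (poly P 0) - q r\<bar> < 1 / 3"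
    using abs_Re_le_cmod[of "poly P 0 - of_real (q r)"] by simp
  thus False using juntas far P(3) by simp
qed

lemma linear_le_power: "n \<ge> 5 \<Longrightarrow> 4 * n + 2 \<le> (2 :: nat) ^ n"
  by (induction n rule: nat_induct_at_least) auto

theorem theorem6p7:
  shows "\<exists>c::real. c > 0 \<and>
    (\<exists>k0::nat. \<forall>k\<ge>k0. \<exists>N::nat. \<forall>A. junta_tester (1 / 5) N k A \<longrightarrow>
       real (queries A) \<ge> c * real k powr (1 / 3))"
proof (rule exI[of _ "1 / 60"], rule conjI, simp, rule exI[of _ 27000], intro allI impI)
  fix k :: nat assume k: "k \<ge> 27000"
  \<comment> \<open>Large enough for \<open>2 ^ l \<ge> 2 * k\<close>, small enough to leave
    \<open>k - l \<ge> k / 2\<close>.\<close>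
  define l where "l = k div 2"
  have kl: "k \<le> 2 * l + 1" "5 \<le> l" "2 * l \<le> k" using k by (auto simp: l_def)
  have l: "l < k" "2 * k \<le> 2 ^ l" "k \<le> 2 * (k - l)"
    using kl linear_le_power[OF kl(2)] by linarith+
  show "\<exists>N. \<forall>A. junta_tester (1 / 5) N k A \<longrightarrow> real (queries A) \<ge> 1 / 60 * real k powr (1 / 3)"
  proof (intro exI[of _ "2 ^ l + l"] allI impI, rule ccontr)
    fix A assume A: "junta_tester (1 / 5) (2 ^ l + l) k A"
    define a where "a = real k powr (1 / 3)"
    have a3: "a ^ 3 = real k" using k by (simp add: a_def powr_power)
    assume "\<not> real (queries A) \<ge> 1 / 60 * real k powr (1 / 3)"
    hence small: "real (queries A) < a / 60" by (simp add: a_def)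
    \<comment> \<open>The threshold is \<open>27000 = 30 ^ 3\<close>. From \<open>a \<ge> 30\<close>
      the summand 1 is at most \<open>a / 30\<close>, and so is \<open>2 * queries A\<close>, which
      gives \<open>a / 15\<close>.\<close>
    have "(30 :: real) ^ 3 \<le> a ^ 3" unfolding a3 using k by simp
    hence "30 \<le> a" by (rule power_le_imp_le_base[of _ 2, simplified]) (simp add: a_def)
    hence "2 * real (queries A) + 1 \<le> a / 15" using small by simp
    hence "(2 * real (queries A) + 1) ^ 3 \<le> (a / 15) ^ 3" by (intro power_mono) auto
    also have "\<dots> = real k / 3375" by (simp add: power_divide a3)
    finally have "(2 * real (queries A) + 1) ^ 3 \<le> real k / 3375" .
    moreover have "k < 3200 * (2 * queries A + 1) ^ 3"
      using junta_tester_queries[OF A refl l(2,1)] l(3) by simp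
    hence "real k < real (3200 * (2 * queries A + 1) ^ 3)" by (simp only: of_nat_less_iff)
    hence "real k < 3200 * (2 * real (queries A) + 1) ^ 3" by (simp add: add.commute)
    \<comment> \<open>The constants \<open>3200 = 2 * 1600\<close> and \<open>3375 = 15 ^ 3\<close>
      satisfy \<open>3200 < 3375\<close>.\<close>
    ultimately show False using k by simp
  qed
qed

end
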